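(* If $\dim E\geq 2$, there is no entire free time minimizer for the Newtonian $N$-body problem in $E$; that is, no curve $x:\mathbb{R}\to E^N$ is a free time minimizer on $\mathbb{R}$.
   Context: $E$ is a finite dimensional Euclidean space with norm $\|\cdot\|$, $N\geq 2$, and $m_1,\dots,m_N>0$ are masses. For $x=(r_1,\dots,r_N)\in E^N$, the Newtonian potential is $U(x)=\sum_{1\leq i<j\leq N} m_i m_j\|r_i-r_j\|^{-1}\in(0,+\infty]$ (with $U(x)=+\infty$ if $r_i=r_j$ for some $i\ne j$). The Lagrangian is $L(x,v)=\frac12\sum_i m_i\|v_i\|^2+U(x)$ and the action of an absolutely continuous curve $\gamma:[a,b]\to E^N$ is $A(\gamma)=\int_a^b L(\gamma(t),\dot\gamma(t))\,dt\in(0,+\infty]$. For $x,y\in E^N$, $\phi(x,y)$ is the infimum of $A(\gamma)$ over all absolutely continuous $\gamma:[a,b]\to E^N$ with $a<b$ arbitrary, $\gamma(a)=x$, $\gamma(b)=y$. A free time minimizer on an interval $J\subset\mathbb{R}$ is a curve $\gamma:J\to E^N$, absolutely continuous on compact subintervals, such that $A(\gamma|_{[a,b]})=\phi(\gamma(a),\gamma(b))$ for every compact subinterval $[a,b]\subset J$ with $a<b$. *)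

theory Defs
  imports "HOL-Analysis.Analysis"
begin

(* Configurations of the N bodies are elements of 'a ^ 'n: the Euclidean space E is 'a and
   N = CARD('n). The linear order on the index type only serves to write sums over i < j. *)

(* The familiar epsilon-delta notion. P is a finite family of non-overlapping intervals [s,t]
   contained in S, each encoded as the pair of its endpoints. Unrelated to the relation
   absolutely_continuous between measures. *)
definition abs_continuous_on :: "real set \<Rightarrow> (real \<Rightarrow> 'b::real_normed_vector) \<Rightarrow> bool" where
  "abs_continuous_on S f \<longleftrightarrow>
    (\<forall>\<epsilon>>0. \<exists>\<delta>>0. \<forall>P. finite P \<and> (\<forall>(s, t)\<in>P. s \<le> t \<and> {s..t} \<subseteq> S) \<and>
        disjoint_family_on (\<lambda>(s, t). {s<..<t}) P \<and> (\<Sum>(s, t)\<in>P. t - s) < \<delta>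
      \<longrightarrow> (\<Sum>(s, t)\<in>P. norm (f t - f s)) < \<epsilon>)"

(* Division in ennreal: c / 0 = \<infinity> for c > 0, so collisions have infinite potential. *)
definition newton_potential :: "('n::{finite,linorder} \<Rightarrow> real) \<Rightarrow> 'a::euclidean_space ^ 'n::_ \<Rightarrow> ennreal" where
  "newton_potential m x =
    (\<Sum>(i, j) | i < j. ennreal (m i * m j) / ennreal (norm (x $ i - x $ j)))"

lemma newton_potential_eq_top_iff:
  fixes x :: "'a::euclidean_space ^ 'n::{finite,linorder}"
  assumes "\<And>i. m i > 0"
  shows "newton_potential m x = \<infinity> \<longleftrightarrow> (\<exists>i j. i \<noteq> j \<and> x $ i = x $ j)"
proof -
  have *: "ennreal (m i * m j) / ennreal (norm (x $ i - x $ j)) = \<infinity> \<longleftrightarrow> x $ i = x $ j" for i j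
    using assms[of i] assms[of j] by (auto simp: ennreal_divide_eq_top_iff ennreal_eq_0_iff mult_le_0_iff)
  have "newton_potential m x = \<infinity> \<longleftrightarrow> (\<exists>i j. i < j \<and> x $ i = x $ j)"
    unfolding newton_potential_def infinity_ennreal_def
    by (subst ennreal_sum_eq_top) (auto simp: *[unfolded infinity_ennreal_def])
  also have "\<dots> \<longleftrightarrow> (\<exists>i j. i \<noteq> j \<and> x $ i = x $ j)"
    by (metis less_irrefl linorder_neqE)
  finally show ?thesis .
qed

definition lagrangian ::
  "('n::{finite,linorder} \<Rightarrow> real) \<Rightarrow> 'a::euclidean_space ^ 'n::_ \<Rightarrow> 'a ^ 'n::_ \<Rightarrow> ennreal" where
  "lagrangian m x v = ennreal (1/2 * (\<Sum>i\<in>UNIV. m i * (norm (v $ i))\<^sup>2)) + newton_potential m x"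

(* Only meaningful for curves absolutely continuous on {a..b}; these are differentiable almost
   everywhere, and the value of vector_derivative elsewhere does not affect the integral. The
   derivative is taken within {a..b}, so the action depends only on the restriction to {a..b}. *)
definition action ::
  "('n::{finite,linorder} \<Rightarrow> real) \<Rightarrow> real \<Rightarrow> real \<Rightarrow> (real \<Rightarrow> 'a::euclidean_space ^ 'n::_) \<Rightarrow> ennreal" where
  "action m a b \<gamma> =
    (\<integral>\<^sup>+t\<in>{a..b}. lagrangian m (\<gamma> t) (vector_derivative \<gamma> (at t within {a..b})) \<partial>lebesgue)"

definition action_potential ::
  "('n::{finite,linorder} \<Rightarrow> real) \<Rightarrow> 'a::euclidean_space ^ 'n::_ \<Rightarrow> 'a ^ 'n::_ \<Rightarrow> ennreal" where
  "action_potential m x y =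
    Inf {action m a b \<gamma> | a b \<gamma>. a < b \<and> abs_continuous_on {a..b} \<gamma> \<and> \<gamma> a = x \<and> \<gamma> b = y}"

definition free_time_minimizer_on ::
  "('n::{finite,linorder} \<Rightarrow> real) \<Rightarrow> real set \<Rightarrow> (real \<Rightarrow> 'a::euclidean_space ^ 'n::_) \<Rightarrow> bool" where
  "free_time_minimizer_on m J \<gamma> \<longleftrightarrow>
    (\<forall>a b. a < b \<and> {a..b} \<subseteq> J \<longrightarrow>
      abs_continuous_on {a..b} \<gamma> \<and> action m a b \<gamma> = action_potential m (\<gamma> a) (\<gamma> b))"

end

theory Submission
  imports Defs "HOL-Real_Asymp.Real_Asymp"
begin

text \<open>
  Suppose \<open>\<gamma>\<close> is an entire free time minimizer, and compare it with the curves
  \<open>\<gamma> \<plusminus> \<psi> d\<close>, where \<open>\<psi>\<close> is a plateau function supported in \<open>[-M, M]\<close> and the displacement \<open>d\<close> moves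
  the \<open>i\<close>-th body by \<open>k\<^sub>i v\<close> with distinct integers \<open>k\<^sub>i\<close>. The two cross terms in the kinetic energy
  cancel, so only a cost of order \<open>\<bar>v\<bar>\<^sup>2 / (M - L)\<close> and the change of the potential remain.

  Let \<open>v\<close> be random in a plane of \<open>E\<close> with the Cauchy density \<open>(1 + \<bar>v\<bar>\<^sup>2)\<^bsup>-3/2\<^esup> / 2\<pi>\<close>. This is the
  balayage onto the plane of a unit charge at height \<open>1\<close>, whence the mean of \<open>1 / \<bar>r + \<rho> v\<bar>\<close> is at most
  \<open>(\<rho>\<^sup>2 + \<bar>r\<bar>\<^sup>2)\<^bsup>-1/2\<^esup>\<close>: on average every displacement lowers the potential. Truncating at \<open>\<bar>v\<bar> \<le> R\<close>, where
  the second moment is of order \<open>R\<close> and the lost mass of order \<open>1/R\<close>, bounds the gain in potential by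
  \<open>C R / (M - L) + C g(M) / R\<close>, with \<open>g(M)\<close> the integral of the potential over \<open>[-M, M]\<close>.

  Large displacements turn this into a superlinear growth inequality for \<open>g\<close>, under which \<open>g\<close> would
  blow up in finite time unless \<open>g(M) = O(M\<^bsup>1/3\<^esup>)\<close>. Displacements of unit size gain a fixed positive
  amount on \<open>[-1, 1]\<close>, while with \<open>M = 1 + R\<^sup>2\<close> the right-hand side tends to \<open>0\<close> as \<open>R \<rightarrow> \<infinity>\<close>.
  The same averaging shows that any two configurations are joined by a curve of finite action.
\<close>

section \<open>The planar Cauchy distribution\<close>

lemma nn_integral_FTC_real_line:
  fixes f F :: "real \<Rightarrow> real"
  assumes [measurable]: "f \<in> borel_measurable borel"
    and deriv: "\<And>x. (F has_real_derivative f x) (at x)"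
    and nonneg: "\<And>x. 0 \<le> f x"
    and top: "(F \<longlongrightarrow> T) at_top" and bot: "(F \<longlongrightarrow> S) at_bot"
  shows "(\<integral>\<^sup>+x. ennreal (f x) \<partial>lborel) = ennreal (T - S)"
proof -
  \<comment> \<open>Reflection turns the left half-line into the right one, with \<open>G\<close> as
    a primitive of \<open>f (- x)\<close>; both halves then become integrals over
    \<open>{0..}\<close>.\<close>
  define G where "G x = - F (- x)" for x
  have G: "(G has_real_derivative f (- x)) (at x)" for x
    unfolding G_def by (auto intro!: derivative_eq_intros DERIV_chain'[OF _ deriv])
  have G_top: "(G \<longlongrightarrow> - S) at_top"
    unfolding G_def using bot by (auto intro!: tendsto_intros simp: filterlim_at_bot_mirror)
  have mono_F: "F x \<le> F y" if "x \<le> y" for x y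
    using that DERIV_nonneg_imp_nondecreasing deriv nonneg by blast
  have "F 0 \<le> T"
    by (rule tendsto_lowerbound[OF top]) (auto intro!: eventually_at_top_linorderI mono_F)
  have "S \<le> F 0"
    by (rule tendsto_upperbound[OF bot]) (auto intro!: eventually_at_bot_linorderI[of 0] mono_F)
  have R: "(\<integral>\<^sup>+x. ennreal (f x) * indicator {0..} x \<partial>lborel) = ennreal (T - F 0)"
    by (rule nn_integral_FTC_atLeast) (auto intro: deriv nonneg top)
  have "(\<integral>\<^sup>+x. ennreal (f x) * indicator {..<0} x \<partial>lborel)
      = (\<integral>\<^sup>+x. ennreal (f x) * indicator {..0} x \<partial>lborel)"
    by (rule nn_integral_cong_AE, rule AE_mp[OF AE_lborel_singleton[of 0]]) (auto split: split_indicator)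
  also have "\<dots> = (\<integral>\<^sup>+x. ennreal (f (- x)) * indicator {0..} x \<partial>lborel)"
    by (subst nn_integral_real_affine[where c="-1" and t=0])
       (auto intro!: nn_integral_cong split: split_indicator)
  also have "\<dots> = ennreal (- S - G 0)"
    by (rule nn_integral_FTC_atLeast) (auto intro: G nonneg G_top)
  finally have L: "(\<integral>\<^sup>+x. ennreal (f x) * indicator {..<0} x \<partial>lborel) = ennreal (F 0 - S)"
    by (simp add: G_def)
  have "(\<integral>\<^sup>+x. ennreal (f x) \<partial>lborel)
      = (\<integral>\<^sup>+x. ennreal (f x) * indicator {..<0} x + ennreal (f x) * indicator {0..} x \<partial>lborel)"
    by (intro nn_integral_cong) (auto split: split_indicator)
  also have "\<dots> = ennreal (F 0 - S) + ennreal (T - F 0)"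
    by (subst nn_integral_add) (auto simp: R L)
  also have "\<dots> = ennreal (T - S)"
    using \<open>F 0 \<le> T\<close> \<open>S \<le> F 0\<close> by (simp flip: ennreal_plus)
  finally show ?thesis .
qed

lemma quadratic_pos:
  fixes A B C y :: real
  assumes "C > 0" "A * C - B\<^sup>2 > 0"
  shows "C * y\<^sup>2 - 2 * B * y + A > 0"
proof -
  have "C * (C * y\<^sup>2 - 2 * B * y + A) = (C * y - B)\<^sup>2 + (A * C - B\<^sup>2)"
    by (simp add: power2_eq_square algebra_simps)
  also have "\<dots> > 0" using assms by (simp add: add_nonneg_pos)
  finally show ?thesis using assms(1) by (simp add: zero_less_mult_iff)
qed

lemma affine_over_sqrt_quadratic_limits:
  fixes A B C D :: real
  assumes "C > 0" "D > 0"
  shows "((\<lambda>y. (C * y - B) / (D * sqrt (C * y\<^sup>2 - 2 * B * y + A))) \<longlongrightarrow> sqrt C / D) at_top"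
    and "((\<lambda>y. (C * y - B) / (D * sqrt (C * y\<^sup>2 - 2 * B * y + A))) \<longlongrightarrow> - sqrt C / D) at_bot"
proof -
  have "C / sqrt C = sqrt C"
    using assms by (intro real_div_sqrt) simp
  \<comment> \<open>The ratio of the leading coefficients is \<open>C / (D * sqrt C)\<close>; this
    brings it to the closed form of the limit.\<close>
  then have *: "C * (inverse D * inverse (C powr (1 / 2))) = sqrt C / D"
    by (metis assms(1) divide_inverse less_imp_le mult.assoc mult.commute powr_half_sqrt)
  show "((\<lambda>y. (C * y - B) / (D * sqrt (C * y\<^sup>2 - 2 * B * y + A))) \<longlongrightarrow> sqrt C / D) at_top"
    using assms * by real_asymp
  show "((\<lambda>y. (C * y - B) / (D * sqrt (C * y\<^sup>2 - 2 * B * y + A))) \<longlongrightarrow> - sqrt C / D) at_bot"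
    using assms * by real_asymp
qed

text \<open>\<open>F\<close> below is a primitive because
  \<open>C * q y - (C * y - B)\<^sup>2\<close> is the constant \<open>A * C - B\<^sup>2\<close>.
  Integrals of the Cauchy density along a line have this form, both for the potential and for the
  marginals.\<close>

lemma nn_integral_quadratic_three_halves:
  fixes A B C :: real
  assumes C: "C > 0" and D: "A * C - B\<^sup>2 > 0"
  defines "q \<equiv> \<lambda>y. C * y\<^sup>2 - 2 * B * y + A"
  shows "(\<integral>\<^sup>+y. ennreal (1 / (q y * sqrt (q y))) \<partial>lborel) = ennreal (2 * sqrt C / (A * C - B\<^sup>2))"
proof -
  have q: "q y > 0" for y unfolding q_def by (rule quadratic_pos[OF C D])
  define F where "F y = (C * y - B) / ((A * C - B\<^sup>2) * sqrt (q y))" for y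
  have F: "(F has_real_derivative 1 / (q y * sqrt (q y))) (at y)" for y
  proof -
    have q': "(q has_real_derivative 2 * (C * y - B)) (at y)"
      unfolding q_def by (auto intro!: derivative_eq_intros simp: algebra_simps)
    have s': "((\<lambda>y. sqrt (q y)) has_real_derivative (C * y - B) / sqrt (q y)) (at y)"
    proof -
      have "((\<lambda>y. sqrt (q y)) has_real_derivative inverse (sqrt (q y)) / 2 * (2 * (C * y - B))) (at y)"
        by (rule DERIV_chain2[OF DERIV_real_sqrt[OF q[of y]] q'])
      moreover have "inverse (sqrt (q y)) / 2 * (2 * (C * y - B)) = (C * y - B) / sqrt (q y)"
        using q[of y] by (simp add: field_simps)
      ultimately show ?thesis by (simp only:)
    qed
    have n: "((\<lambda>y. C * y - B) has_real_derivative C) (at y)"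
      by (auto intro!: derivative_eq_intros)
    have "sqrt (q y) \<noteq> 0" using q[of y] by simp
    with n s' have deriv: "((\<lambda>y. (C * y - B) / sqrt (q y)) has_real_derivative
        (C * sqrt (q y) - (C * y - B) * ((C * y - B) / sqrt (q y))) / (sqrt (q y) * sqrt (q y))) (at y)"
      by (rule DERIV_divide)
    have *: "(C * r - z * (z / r)) / (r * r) = (C * (r * r) - z\<^sup>2) / (r * r * r)" if "r > 0" for r z
      using that by (simp add: field_simps power2_eq_square)
    have "sqrt (q y) * sqrt (q y) = q y" using q[of y] by simp
    then have "(C * sqrt (q y) - (C * y - B) * ((C * y - B) / sqrt (q y))) / (sqrt (q y) * sqrt (q y))
        = (C * q y - (C * y - B)\<^sup>2) / (q y * sqrt (q y))"
      using *[of "sqrt (q y)" "C * y - B"] q[of y] by simp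
    also have "C * q y - (C * y - B)\<^sup>2 = A * C - B\<^sup>2"
      by (simp add: q_def power2_eq_square algebra_simps)
    finally have "((\<lambda>y. (C * y - B) / sqrt (q y)) has_real_derivative
        (A * C - B\<^sup>2) / (q y * sqrt (q y))) (at y)" using deriv by simp
    from DERIV_cdivide[OF this, of "A * C - B\<^sup>2"] show ?thesis
      using D unfolding F_def by (simp add: mult.commute)
  qed
  have lim: "(F \<longlongrightarrow> sqrt C / (A * C - B\<^sup>2)) at_top" "(F \<longlongrightarrow> - sqrt C / (A * C - B\<^sup>2)) at_bot"
    unfolding F_def q_def by (rule affine_over_sqrt_quadratic_limits[OF C D])+
  have "(\<integral>\<^sup>+y. ennreal (1 / (q y * sqrt (q y))) \<partial>lborel)
      = ennreal (sqrt C / (A * C - B\<^sup>2) - (- sqrt C / (A * C - B\<^sup>2)))"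
  proof (rule nn_integral_FTC_real_line[OF _ F _ lim])
    show "(\<lambda>y. 1 / (q y * sqrt (q y))) \<in> borel_measurable borel" unfolding q_def by measurable
    show "0 \<le> 1 / (q y * sqrt (q y))" for y using q[of y] by simp
  qed
  then show ?thesis by simp
qed

text \<open>Completing the square gives an arctangent. This serves the second integration for the
  potential, the total mass and the tail.\<close>

lemma nn_integral_inverse_quadratic:
  fixes a b c :: real
  assumes a: "a > 0" and D: "c * a - b\<^sup>2 > 0"
  shows "(\<integral>\<^sup>+k. ennreal (1 / (a * k\<^sup>2 - 2 * b * k + c)) \<partial>lborel) = ennreal (pi / sqrt (c * a - b\<^sup>2))"
proof -
  define d where "d = sqrt (c * a - b\<^sup>2)"
  have d: "d > 0" "d\<^sup>2 = c * a - b\<^sup>2" using D by (auto simp: d_def)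
  have q: "a * k\<^sup>2 - 2 * b * k + c > 0" for k by (rule quadratic_pos[OF a D])
  have F: "((\<lambda>k. arctan ((a * k - b) / d) / d) has_real_derivative 1 / (a * k\<^sup>2 - 2 * b * k + c)) (at k)" for k
  proof -
    have *: "d\<^sup>2 + (a * k - b)\<^sup>2 = a * (a * k\<^sup>2 - 2 * b * k + c)"
      unfolding d(2) by (simp add: power2_eq_square algebra_simps)
    have "1 + ((a * k - b) / d)\<^sup>2 = a * (a * k\<^sup>2 - 2 * b * k + c) / d\<^sup>2"
      unfolding *[symmetric] using d(1) by (simp add: field_simps)
    then have "inverse (1 + ((a * k - b) / d)\<^sup>2) * (a / d) / d = 1 / (a * k\<^sup>2 - 2 * b * k + c)"
      using a q[of k] d(1) by (simp add: power2_eq_square)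
    moreover have "((\<lambda>k. arctan ((a * k - b) / d) / d) has_real_derivative
       inverse (1 + ((a * k - b) / d)\<^sup>2) * (a / d) / d) (at k)"
      using d by (auto intro!: derivative_eq_intros)
    ultimately show ?thesis by simp
  qed
  have T: "((\<lambda>k. arctan ((a * k - b) / d) / d) \<longlongrightarrow> pi / 2 / d) at_top"
    using a d(1) by (real_asymp simp: field_simps)
  have S: "((\<lambda>k. arctan ((a * k - b) / d) / d) \<longlongrightarrow> - (pi / 2) / d) at_bot"
    using a d(1) by (real_asymp simp: field_simps)
  have "(\<integral>\<^sup>+k. ennreal (1 / (a * k\<^sup>2 - 2 * b * k + c)) \<partial>lborel) = ennreal (pi / 2 / d - (- (pi / 2) / d))"
    by (rule nn_integral_FTC_real_line[OF _ F _ T S]) (use q in \<open>auto simp: less_imp_le\<close>)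
  then show ?thesis by (simp add: d_def field_simps)
qed

text \<open>The Poisson kernel of a half-space seen from height 1. It lives on pairs of reals, not
  on a plane in E, so that iterated integrals apply; the plane enters later through
  \<open>e1\<close> and \<open>e2\<close>.\<close>

definition planar_cauchy :: "(real \<times> real) measure" where
  "planar_cauchy = density lborel
     (\<lambda>(a, b). ennreal (1 / (2 * pi * ((1 + a\<^sup>2 + b\<^sup>2) * sqrt (1 + a\<^sup>2 + b\<^sup>2)))))"

lemma sets_planar_cauchy [simp, measurable_cong]: "sets planar_cauchy = sets borel"
  by (simp add: planar_cauchy_def)

lemma space_planar_cauchy [simp]: "space planar_cauchy = UNIV"
  by (simp add: planar_cauchy_def)

lemma nn_integral_planar_cauchy:
  assumes [measurable]: "f \<in> borel_measurable borel"
  shows "(\<integral>\<^sup>+s. f s \<partial>planar_cauchy) = (\<integral>\<^sup>+a. \<integral>\<^sup>+b.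
    ennreal (1 / (2 * pi * ((1 + a\<^sup>2 + b\<^sup>2) * sqrt (1 + a\<^sup>2 + b\<^sup>2)))) * f (a, b) \<partial>lborel \<partial>lborel)"
proof -
  have [measurable]: "f \<in> borel_measurable (borel \<Otimes>\<^sub>M borel)"
    by (simp add: borel_prod)
  have "(\<integral>\<^sup>+s. f s \<partial>planar_cauchy) = (\<integral>\<^sup>+s. (case s of (a, b) \<Rightarrow>
    ennreal (1 / (2 * pi * ((1 + a\<^sup>2 + b\<^sup>2) * sqrt (1 + a\<^sup>2 + b\<^sup>2))))) * f s \<partial>(lborel \<Otimes>\<^sub>M lborel))"
    unfolding planar_cauchy_def lborel_prod by (rule nn_integral_density) (simp_all add: measurable_lborel1, subst borel_prod[symmetric], measurable)
  also have "\<dots> = (\<integral>\<^sup>+a. \<integral>\<^sup>+b.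
    ennreal (1 / (2 * pi * ((1 + a\<^sup>2 + b\<^sup>2) * sqrt (1 + a\<^sup>2 + b\<^sup>2)))) * f (a, b) \<partial>lborel \<partial>lborel)"
    by (subst lborel.nn_integral_fst[symmetric]) auto
  finally show ?thesis .
qed

text \<open>In the coordinates \<open>(y, k)\<close> with \<open>x + s = (y, k y)\<close> the singularity is cancelled by the
  Jacobian \<open>\<bar>y\<bar>\<close>, and both remaining integrals are elementary.\<close>

lemma planar_cauchy_potential:
  fixes x1 x2 :: real
  shows "(\<integral>\<^sup>+(a, b). 1 / ennreal (sqrt ((x1 + a)\<^sup>2 + (x2 + b)\<^sup>2)) \<partial>planar_cauchy)
    = ennreal (1 / sqrt (1 + x1\<^sup>2 + x2\<^sup>2))"
proof -
  define c where "c a b = 1 / (2 * pi * ((1 + a\<^sup>2 + b\<^sup>2) * sqrt (1 + a\<^sup>2 + b\<^sup>2)))" for a b :: real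
  have [measurable]: "(\<lambda>(a, b). c a b) \<in> borel_measurable (borel \<Otimes>\<^sub>M borel)"
    unfolding c_def by measurable
  have c_nonneg: "0 \<le> c a b" for a b by (simp add: c_def)
  have "(\<integral>\<^sup>+(a, b). 1 / ennreal (sqrt ((x1 + a)\<^sup>2 + (x2 + b)\<^sup>2)) \<partial>planar_cauchy)
      = (\<integral>\<^sup>+a. \<integral>\<^sup>+b. ennreal (c a b) * (1 / ennreal (sqrt ((x1 + a)\<^sup>2 + (x2 + b)\<^sup>2))) \<partial>lborel \<partial>lborel)"
    
  proof -
    have "(\<lambda>(a, b). 1 / ennreal (sqrt ((x1 + a)\<^sup>2 + (x2 + b)\<^sup>2))) \<in> borel_measurable borel"
      by (subst borel_prod[symmetric]) measurable
    then show ?thesis unfolding c_def by (simp add: nn_integral_planar_cauchy)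
  qed
  also have "\<dots> = (\<integral>\<^sup>+y. \<integral>\<^sup>+z. ennreal (c (y - x1) (z - x2)) * (1 / ennreal (sqrt (y\<^sup>2 + z\<^sup>2))) \<partial>lborel \<partial>lborel)"
  proof -
    have "(\<integral>\<^sup>+b. ennreal (c a b) * (1 / ennreal (sqrt ((x1 + a)\<^sup>2 + (x2 + b)\<^sup>2))) \<partial>lborel)
      = (\<integral>\<^sup>+z. ennreal (c a (z - x2)) * (1 / ennreal (sqrt ((x1 + a)\<^sup>2 + z\<^sup>2))) \<partial>lborel)" for a
      by (subst nn_integral_real_affine[where c=1 and t="-x2"]) (auto simp: add.commute)
    then show ?thesis
      by (simp, subst nn_integral_real_affine[where c=1 and t="-x1"]) (auto simp: add.commute)
  qed
  also have "\<dots> = (\<integral>\<^sup>+y. \<integral>\<^sup>+k. ennreal (c (y - x1) (k * y - x2) / sqrt (1 + k\<^sup>2)) \<partial>lborel \<partial>lborel)"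
  proof -
    have "(\<integral>\<^sup>+z. ennreal (c (y - x1) (z - x2)) * (1 / ennreal (sqrt (y\<^sup>2 + z\<^sup>2))) \<partial>lborel)
        = (\<integral>\<^sup>+k. ennreal (c (y - x1) (k * y - x2) / sqrt (1 + k\<^sup>2)) \<partial>lborel)"
      if y: "y \<noteq> 0" for y
    proof -
    have "ennreal \<bar>y\<bar> * (ennreal (c (y - x1) (y * k - x2)) * (1 / ennreal (sqrt (y\<^sup>2 + (y * k)\<^sup>2))))
        = ennreal (c (y - x1) (k * y - x2) / sqrt (1 + k\<^sup>2))" for k
    proof -
      have "sqrt (y\<^sup>2 + (y * k)\<^sup>2) = sqrt (y\<^sup>2 * (1 + k\<^sup>2))"
        by (simp add: power_mult_distrib algebra_simps)
      also have "\<dots> = \<bar>y\<bar> * sqrt (1 + k\<^sup>2)" by (simp add: real_sqrt_mult)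
      finally have *: "sqrt (y\<^sup>2 + (y * k)\<^sup>2) = \<bar>y\<bar> * sqrt (1 + k\<^sup>2)" .
      have "sqrt (1 + k\<^sup>2) > 0" by (simp add: add_pos_nonneg)
      then show ?thesis unfolding *
        using y c_nonneg[of "y - x1" "y * k - x2"]
        by (simp add: divide_ennreal ennreal_mult'[symmetric] ennreal_1[symmetric] mult.commute[of k y] del: ennreal_1)
    qed
    then show ?thesis
      using y by (subst nn_integral_real_affine[where c=y and t=0]) (auto simp flip: nn_integral_cmult)
    qed
    then show ?thesis
      by (intro nn_integral_cong_AE) (use AE_lborel_singleton[of 0] in auto)
  qed
  also have "\<dots> = (\<integral>\<^sup>+k. \<integral>\<^sup>+y. ennreal (c (y - x1) (k * y - x2) / sqrt (1 + k\<^sup>2)) \<partial>lborel \<partial>lborel)"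
    by (rule lborel_pair.Fubini') measurable
  also have "\<dots> = (\<integral>\<^sup>+k. ennreal (1 / pi) *
      ennreal (1 / ((1 + x1\<^sup>2) * k\<^sup>2 - 2 * (x1 * x2) * k + (1 + x2\<^sup>2))) \<partial>lborel)"
  proof (rule nn_integral_cong)
    fix k :: real
    define B where "B = x1 + k * x2"
    define A where "A = 1 + x1\<^sup>2 + x2\<^sup>2"
    define D where "D = (1 + x1\<^sup>2) * k\<^sup>2 - 2 * (x1 * x2) * k + (1 + x2\<^sup>2)"
    \<comment> \<open>The determinant of the quadratic in \<open>y\<close> is itself a quadratic in
      \<open>k\<close>. As the factors \<open>sqrt (1 + k\<^sup>2)\<close> cancel, the outer
      integral is of arctangent type.\<close>
    have D: "A * (1 + k\<^sup>2) - B\<^sup>2 = D"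
      by (simp add: A_def B_def D_def power2_eq_square algebra_simps)
    have "D = 1 + k\<^sup>2 + (k * x1 - x2)\<^sup>2" by (simp add: D_def power2_eq_square algebra_simps)
    then have "D > 0" by (simp add: add_pos_nonneg)
    have C: "1 + k\<^sup>2 > 0" by (simp add: add_pos_nonneg)
    have "c (y - x1) (k * y - x2) / sqrt (1 + k\<^sup>2) = 1 / (2 * pi * sqrt (1 + k\<^sup>2)) *
       (1 / (((1 + k\<^sup>2) * y\<^sup>2 - 2 * B * y + A) * sqrt ((1 + k\<^sup>2) * y\<^sup>2 - 2 * B * y + A)))" for y
    proof -
      have "1 + (y - x1)\<^sup>2 + (k * y - x2)\<^sup>2 = (1 + k\<^sup>2) * y\<^sup>2 - 2 * B * y + A"
        by (simp add: A_def B_def power2_eq_square algebra_simps)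
      then show ?thesis by (simp add: c_def mult_ac)
    qed
    moreover have "0 \<le> 1 / (2 * pi * sqrt (1 + k\<^sup>2))" by simp
    ultimately have "ennreal (c (y - x1) (k * y - x2) / sqrt (1 + k\<^sup>2)) = ennreal (1 / (2 * pi * sqrt (1 + k\<^sup>2))) *
       ennreal (1 / (((1 + k\<^sup>2) * y\<^sup>2 - 2 * B * y + A) * sqrt ((1 + k\<^sup>2) * y\<^sup>2 - 2 * B * y + A)))" for y
      by (metis ennreal_mult')
    then have "(\<integral>\<^sup>+y. ennreal (c (y - x1) (k * y - x2) / sqrt (1 + k\<^sup>2)) \<partial>lborel)
       = ennreal (1 / (2 * pi * sqrt (1 + k\<^sup>2))) * ennreal (2 * sqrt (1 + k\<^sup>2) / D)"
      using nn_integral_quadratic_three_halves[OF C, of A B] \<open>D > 0\<close> D by (simp add: nn_integral_cmult)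
    also have "\<dots> = ennreal (1 / pi) * ennreal (1 / D)"
      using C \<open>D > 0\<close> by (simp flip: ennreal_mult')
    finally show "(\<integral>\<^sup>+y. ennreal (c (y - x1) (k * y - x2) / sqrt (1 + k\<^sup>2)) \<partial>lborel)
       = ennreal (1 / pi) * ennreal (1 / ((1 + x1\<^sup>2) * k\<^sup>2 - 2 * (x1 * x2) * k + (1 + x2\<^sup>2)))"
      by (simp add: D_def)
  qed
  also have "\<dots> = ennreal (1 / pi) * ennreal (pi / sqrt (1 + x1\<^sup>2 + x2\<^sup>2))"
  proof -
    \<comment> \<open>The determinant of the outer quadratic is the squared distance from
      \<open>(x1, x2)\<close> to the point at height 1 above the origin.\<close>
    have *: "(1 + x2\<^sup>2) * (1 + x1\<^sup>2) - (x1 * x2)\<^sup>2 = 1 + x1\<^sup>2 + x2\<^sup>2"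
      by (simp add: power2_eq_square algebra_simps)
    have "0 < 1 + x1\<^sup>2 + x2\<^sup>2" "0 < 1 + x1\<^sup>2" by (simp_all add: add_pos_nonneg)
    then show ?thesis
      by (subst nn_integral_cmult)
         (simp_all add: nn_integral_inverse_quadratic[where a="1 + x1\<^sup>2" and b="x1 * x2" and c="1 + x2\<^sup>2"] *)
  qed
  also have "\<dots> = ennreal (1 / sqrt (1 + x1\<^sup>2 + x2\<^sup>2))"
    by (simp flip: ennreal_mult')
  finally show ?thesis .
qed

text \<open>The density is even. Hence \<open>s\<close> and \<open>- s\<close> can be paired, both
  in comparing potentials and in averaging over the two oppositely displaced curves.\<close>

lemma nn_integral_planar_cauchy_uminus:
  assumes [measurable]: "f \<in> borel_measurable borel"
  shows "(\<integral>\<^sup>+s. f (- s) \<partial>planar_cauchy) = (\<integral>\<^sup>+s. f s \<partial>planar_cauchy)"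
proof -
  have [measurable]: "f \<in> borel_measurable (borel \<Otimes>\<^sub>M borel)"
    by (simp add: borel_prod)
  define c where "c a b = ennreal (1 / (2 * pi * ((1 + a\<^sup>2 + b\<^sup>2) * sqrt (1 + a\<^sup>2 + b\<^sup>2))))" for a b :: real
  have [measurable]: "(\<lambda>(a, b). c a b) \<in> borel_measurable (borel \<Otimes>\<^sub>M borel)"
    unfolding c_def by measurable
  have c_minus [simp]: "c (- a) b = c a b" "c a (- b) = c a b" for a b by (simp_all add: c_def)
  have inner: "(\<integral>\<^sup>+b. c a b * f (a, b) \<partial>lborel) = (\<integral>\<^sup>+b. c a b * f (a, - b) \<partial>lborel)" for a
    by (subst nn_integral_real_affine[where c="-1" and t=0]) auto
  have "(\<integral>\<^sup>+s. f s \<partial>planar_cauchy) = (\<integral>\<^sup>+a. \<integral>\<^sup>+b. c a b * f (a, - b) \<partial>lborel \<partial>lborel)"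
    by (subst nn_integral_planar_cauchy) (auto simp: inner simp flip: c_def)
  also have "\<dots> = (\<integral>\<^sup>+a. \<integral>\<^sup>+b. c a b * f (- a, - b) \<partial>lborel \<partial>lborel)"
    by (subst nn_integral_real_affine[where c="-1" and t=0]) auto
  also have "\<dots> = (\<integral>\<^sup>+s. f (- s) \<partial>planar_cauchy)"
    by (subst nn_integral_planar_cauchy) (auto simp flip: c_def)
  finally show ?thesis ..
qed

text \<open>Integrating out one coordinate leaves the one-dimensional Cauchy density. The later
  truncation is to a square, coordinate by coordinate, so these marginals suffice for it.\<close>

lemma nn_integral_planar_cauchy_marginals:
  assumes [measurable]: "f \<in> borel_measurable borel"
  shows "(\<integral>\<^sup>+s. f (fst s) \<partial>planar_cauchy) = (\<integral>\<^sup>+a. ennreal (1 / (pi * (1 + a\<^sup>2))) * f a \<partial>lborel)" (is ?fst)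
    and "(\<integral>\<^sup>+s. f (snd s) \<partial>planar_cauchy) = (\<integral>\<^sup>+a. ennreal (1 / (pi * (1 + a\<^sup>2))) * f a \<partial>lborel)" (is ?snd)
proof -
  define c where "c a b = ennreal (1 / (2 * pi * ((1 + a\<^sup>2 + b\<^sup>2) * sqrt (1 + a\<^sup>2 + b\<^sup>2))))" for a b :: real
  have [measurable]: "(\<lambda>(a, b). c a b) \<in> borel_measurable (borel \<Otimes>\<^sub>M borel)"
    unfolding c_def by measurable
  have [measurable]: "fst \<in> borel_measurable (borel :: (real \<times> real) measure)"
    "snd \<in> borel_measurable (borel :: (real \<times> real) measure)"
    by (simp_all flip: borel_prod)
  have inner: "(\<integral>\<^sup>+b. c a b \<partial>lborel) = ennreal (1 / (pi * (1 + a\<^sup>2)))" for a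
  proof -
    have pos: "0 < 1 + a\<^sup>2" by (simp add: add_pos_nonneg)
    have "c a b = ennreal (1 / (2 * pi)) *
      ennreal (1 / ((1 * b\<^sup>2 - 2 * 0 * b + (1 + a\<^sup>2)) * sqrt (1 * b\<^sup>2 - 2 * 0 * b + (1 + a\<^sup>2))))" for b
      unfolding c_def by (subst ennreal_mult'[symmetric]) (simp_all add: add_ac)
    then have "(\<integral>\<^sup>+b. c a b \<partial>lborel) = ennreal (1 / (2 * pi)) * ennreal (2 * sqrt 1 / ((1 + a\<^sup>2) * 1 - 0\<^sup>2))"
      using nn_integral_quadratic_three_halves[of 1 "1 + a\<^sup>2" 0] pos by (simp add: nn_integral_cmult)
    also have "\<dots> = ennreal (1 / (pi * (1 + a\<^sup>2)))"
      by (subst ennreal_mult'[symmetric]) simp_all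
    finally show ?thesis .
  qed
  have "(\<integral>\<^sup>+s. f (fst s) \<partial>planar_cauchy) = (\<integral>\<^sup>+a. \<integral>\<^sup>+b. c a b * f a \<partial>lborel \<partial>lborel)"
    by (subst nn_integral_planar_cauchy) (auto simp flip: c_def)
  then show ?fst by (simp add: nn_integral_multc inner)
  have sym: "c a b = c b a" for a b by (simp add: c_def add_ac)
  have "(\<integral>\<^sup>+s. f (snd s) \<partial>planar_cauchy) = (\<integral>\<^sup>+a. \<integral>\<^sup>+b. c a b * f b \<partial>lborel \<partial>lborel)"
    by (subst nn_integral_planar_cauchy) (auto simp flip: c_def)
  also have "\<dots> = (\<integral>\<^sup>+b. \<integral>\<^sup>+a. c a b * f b \<partial>lborel \<partial>lborel)"
    by (rule lborel_pair.Fubini') measurable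
  also have "\<dots> = (\<integral>\<^sup>+b. \<integral>\<^sup>+a. c b a * f b \<partial>lborel \<partial>lborel)"
    by (simp add: sym)
  finally show ?snd by (simp add: nn_integral_multc inner)
qed

lemma emeasure_planar_cauchy_UNIV: "emeasure planar_cauchy UNIV = 1"
proof -
  have "ennreal (1 / (pi * (1 + a\<^sup>2))) = ennreal (1 / pi) * ennreal (1 / (1 * a\<^sup>2 - 2 * 0 * a + 1))" for a :: real
    by (subst ennreal_mult'[symmetric]) (simp_all add: add_ac)
  then have "(\<integral>\<^sup>+s. 1 \<partial>planar_cauchy) = ennreal (1 / pi) * ennreal pi"
    using nn_integral_planar_cauchy_marginals(1)[of "\<lambda>_. 1"] nn_integral_inverse_quadratic[of 1 1 0]
    by (simp add: nn_integral_cmult)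
  also have "\<dots> = 1" by (subst ennreal_mult'[symmetric]) simp_all
  finally show ?thesis by simp
qed

interpretation planar_cauchy: finite_measure planar_cauchy
  by (rule finite_measureI) (simp add: emeasure_planar_cauchy_UNIV)

text \<open>On the tail \<open>a\<^sup>2 + R\<^sup>2 \<le> 2 * (1 + a\<^sup>2)\<close>, and the
  resulting majorant integrates to exactly \<open>2 / R\<close> over the whole line.\<close>

lemma cauchy_tail_le:
  fixes R :: real
  assumes "R \<ge> 1"
  shows "(\<integral>\<^sup>+a. ennreal (1 / (pi * (1 + a\<^sup>2))) * indicator {a. R < \<bar>a\<bar>} a \<partial>lborel) \<le> ennreal (2 / R)"
proof -
  have "ennreal (1 / (pi * (1 + a\<^sup>2))) * indicator {a. R < \<bar>a\<bar>} a
      \<le> ennreal (2 / pi) * ennreal (1 / (1 * a\<^sup>2 - 2 * 0 * a + R\<^sup>2))" for a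
  proof (cases "R < \<bar>a\<bar>")
    case True
    then have "R\<^sup>2 \<le> a\<^sup>2" using assms by (metis abs_le_square_iff abs_of_nonneg less_imp_le order_trans zero_le_one)
    moreover have "1 \<le> R\<^sup>2" using assms by simp
    moreover have "0 < a\<^sup>2 + R\<^sup>2" using assms by (simp add: add_nonneg_pos)
    ultimately have "1 / (1 + a\<^sup>2) \<le> 2 / (a\<^sup>2 + R\<^sup>2)"
      using add_pos_nonneg[of 1 "a\<^sup>2"] by (simp add: divide_simps)
    then have "1 / pi * (1 / (1 + a\<^sup>2)) \<le> 1 / pi * (2 / (a\<^sup>2 + R\<^sup>2))"
      by (intro mult_left_mono) auto
    then show ?thesis using True by (simp add: ennreal_mult'[symmetric] ennreal_leI)
  qed simp
  then have "(\<integral>\<^sup>+a. ennreal (1 / (pi * (1 + a\<^sup>2))) * indicator {a. R < \<bar>a\<bar>} a \<partial>lborel)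
     \<le> (\<integral>\<^sup>+a. ennreal (2 / pi) * ennreal (1 / (1 * a\<^sup>2 - 2 * 0 * a + R\<^sup>2)) \<partial>lborel)"
    by (intro nn_integral_mono)
  also have "\<dots> = ennreal (2 / pi) * ennreal (pi / sqrt (R\<^sup>2 * 1 - 0\<^sup>2))"
    using assms by (subst nn_integral_cmult) (simp_all add: nn_integral_inverse_quadratic[of 1 "R\<^sup>2" 0, simplified])
  also have "\<dots> = ennreal (2 / R)"
    using assms by (simp add: ennreal_mult'[symmetric])
  finally show ?thesis .
qed

text \<open>The full second moment is infinite, which forces the truncation. On
  \<open>{-R..R}\<close> the integrand is at most \<open>1 / pi\<close>, hence at most
  \<open>1 / 2\<close>, over a length of \<open>2 * R\<close>.\<close>

lemma cauchy_truncated_second_moment_le: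
  fixes R :: real
  assumes "R \<ge> 0"
  shows "(\<integral>\<^sup>+a. ennreal (1 / (pi * (1 + a\<^sup>2))) * (ennreal (a\<^sup>2) * indicator {-R..R} a) \<partial>lborel) \<le> ennreal R"
proof -
  define k :: real where "k = 1 / 2"
  have "0 \<le> k" by (simp add: k_def)
  have "ennreal (1 / (pi * (1 + a\<^sup>2))) * (ennreal (a\<^sup>2) * indicator {-R..R} a) \<le> ennreal k * indicator {-R..R} a" for a
  proof -
    have "a\<^sup>2 * 2 \<le> (1 + a\<^sup>2) * pi"
      using pi_ge_two by (intro mult_mono) auto
    then have "1 / (pi * (1 + a\<^sup>2)) * a\<^sup>2 \<le> k"
      by (simp add: k_def divide_simps add_pos_nonneg mult_ac)
    then show ?thesis
      by (simp add: ennreal_mult'[symmetric] ennreal_leI split: split_indicator)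
  qed
  then have "(\<integral>\<^sup>+a. ennreal (1 / (pi * (1 + a\<^sup>2))) * (ennreal (a\<^sup>2) * indicator {-R..R} a) \<partial>lborel)
     \<le> (\<integral>\<^sup>+a. ennreal k * indicator {-R..R} a \<partial>lborel)"
    by (intro nn_integral_mono)
  also have "\<dots> = ennreal (k * (2 * R))"
    using assms \<open>0 \<le> k\<close> by (simp add: nn_integral_cmult_indicator ennreal_mult')
  finally show ?thesis by (simp add: k_def)
qed

text \<open>The sum is even in \<open>s\<close>: its square is \<open>2 * A / (A\<^sup>2 -
  s\<^sup>2) + 2 / sqrt (A\<^sup>2 - s\<^sup>2)\<close>, which increases with
  \<open>\<bar>s\<bar>\<close>. At \<open>\<bar>t\<bar> = A\<close> the right side is
  infinite.\<close>

lemma inverse_sqrt_pair_mono: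
  fixes A s t :: real
  assumes "\<bar>s\<bar> \<le> \<bar>t\<bar>" "\<bar>t\<bar> \<le> A"
  shows "1 / ennreal (sqrt (A + s)) + 1 / ennreal (sqrt (A - s))
    \<le> 1 / ennreal (sqrt (A + t)) + 1 / ennreal (sqrt (A - t))"
proof (cases "\<bar>t\<bar> = A")
  case True
  then have "A + t = 0 \<or> A - t = 0" by auto
  then show ?thesis by (auto simp: ennreal_divide_eq_top_iff)
next
  case False
  then have t: "0 < A + t" "0 < A - t" and s: "0 < A + s" "0 < A - s"
    using assms by auto
  have sq: "(1 / sqrt (A + x) + 1 / sqrt (A - x))\<^sup>2 = 2 * A / (A\<^sup>2 - x\<^sup>2) + 2 / sqrt (A\<^sup>2 - x\<^sup>2)"
    if "0 < A + x" "0 < A - x" for x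
  proof -
    have *: "A\<^sup>2 - x\<^sup>2 = (A + x) * (A - x)" by (simp add: power2_eq_square algebra_simps)
    have "(1 / sqrt (A + x) + 1 / sqrt (A - x))\<^sup>2
        = 1 / (A + x) + 1 / (A - x) + 2 / (sqrt (A + x) * sqrt (A - x))"
      using that by (simp add: power2_sum power_divide)
    also have "1 / (A + x) + 1 / (A - x) = 2 * A / ((A + x) * (A - x))"
      using that by (simp add: field_simps)
    finally show ?thesis by (simp add: * real_sqrt_mult)
  qed
  have st: "s\<^sup>2 \<le> t\<^sup>2" using assms by (simp add: abs_le_square_iff)
  have "A\<^sup>2 - t\<^sup>2 = (A + t) * (A - t)" by (simp add: power2_eq_square algebra_simps)
  then have "A\<^sup>2 - t\<^sup>2 > 0" using t by simp
  moreover have "0 \<le> A" using assms by linarith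
  ultimately have "2 * A / (A\<^sup>2 - s\<^sup>2) + 2 / sqrt (A\<^sup>2 - s\<^sup>2) \<le> 2 * A / (A\<^sup>2 - t\<^sup>2) + 2 / sqrt (A\<^sup>2 - t\<^sup>2)"
    using st by (intro add_mono divide_left_mono mult_pos_pos) (auto intro: order_less_le_trans)
  then have "(1 / sqrt (A + s) + 1 / sqrt (A - s))\<^sup>2 \<le> (1 / sqrt (A + t) + 1 / sqrt (A - t))\<^sup>2"
    using s t by (simp add: sq)
  then have "1 / sqrt (A + s) + 1 / sqrt (A - s) \<le> 1 / sqrt (A + t) + 1 / sqrt (A - t)"
    using t by (rule_tac power2_le_imp_le) (auto simp: add_nonneg_nonneg)
  then have "ennreal (1 / sqrt (A + s) + 1 / sqrt (A - s)) \<le> ennreal (1 / sqrt (A + t) + 1 / sqrt (A - t))"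
    by (rule ennreal_leI)
  moreover have "1 / ennreal (sqrt x) = ennreal (1 / sqrt x)" if "0 < x" for x
    using that divide_ennreal[of 1 "sqrt x"] by simp
  ultimately show ?thesis
    using s t by simp
qed

text \<open>For \<open>r\<close> in the plane this is \<open>planar_cauchy_potential\<close>.
  Otherwise \<open>r\<close> is turned into the plane with its length kept. Its inner products with
  the displacements then grow in absolute value, so that, with \<open>s\<close> and
  \<open>- s\<close> paired, \<open>inverse_sqrt_pair_mono\<close> shows that the mean only grows.
  Scaling reduces to \<open>c = 1\<close>.\<close>

lemma nn_integral_planar_cauchy_inverse_norm_le:
  fixes r e1 e2 :: "'a::euclidean_space" and c :: real
  assumes e: "e1 \<in> Basis" "e2 \<in> Basis" "e1 \<noteq> e2" and "0 \<le> c"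
  shows "(\<integral>\<^sup>+(a, b). 1 / ennreal (norm (r + c *\<^sub>R (a *\<^sub>R e1 + b *\<^sub>R e2))) \<partial>planar_cauchy)
    \<le> 1 / ennreal (sqrt (c\<^sup>2 + (norm r)\<^sup>2))"
proof -
  have unit: "(\<integral>\<^sup>+(a, b). 1 / ennreal (norm (r + (a *\<^sub>R e1 + b *\<^sub>R e2))) \<partial>planar_cauchy)
    \<le> 1 / ennreal (sqrt (1 + (norm r)\<^sup>2))" for r :: 'a
  proof -
    define p q where "p = r \<bullet> e1" and "q = r \<bullet> e2"
    \<comment> \<open>\<open>(x1, x2)\<close> is to have the length of \<open>r\<close> and the
      direction of its projection \<open>(p, q)\<close>; if the projection vanishes, any direction
      serves.\<close>
    define l where "l = (if p = 0 \<and> q = 0 then 0 else norm r / sqrt (p\<^sup>2 + q\<^sup>2))"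
    define x1 x2 where "x1 = (if p = 0 \<and> q = 0 then norm r else l * p)" and "x2 = l * q"
    define F where "F = (\<lambda>(a, b). 1 / ennreal (norm (r + (a *\<^sub>R e1 + b *\<^sub>R e2))))"
    define G where "G = (\<lambda>(a, b). 1 / ennreal (sqrt ((x1 + a)\<^sup>2 + (x2 + b)\<^sup>2)))"
    have [measurable]: "F \<in> borel_measurable borel" "G \<in> borel_measurable borel"
      unfolding F_def G_def by (subst borel_prod[symmetric], measurable)+
    have e': "e1 \<bullet> e1 = 1" "e2 \<bullet> e2 = 1" "e1 \<bullet> e2 = 0" "e2 \<bullet> e1 = 0"
      using e by (auto simp: inner_not_same_Basis)
    have pq: "p\<^sup>2 + q\<^sup>2 \<le> (norm r)\<^sup>2"
    proof -
      have "0 \<le> (r - p *\<^sub>R e1 - q *\<^sub>R e2) \<bullet> (r - p *\<^sub>R e1 - q *\<^sub>R e2)" by simp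
      also have "\<dots> = (norm r)\<^sup>2 - (p\<^sup>2 + q\<^sup>2)"
        by (simp only: power2_norm_eq_inner inner_diff_left inner_diff_right inner_scaleR_left inner_scaleR_right
            e' p_def q_def inner_commute[of e1 r] inner_commute[of e2 r]) (simp add: power2_eq_square)
      finally show ?thesis by simp
    qed
    have x: "x1\<^sup>2 + x2\<^sup>2 = (norm r)\<^sup>2"
    proof (cases "p = 0 \<and> q = 0")
      case False
      then have "0 < p\<^sup>2 + q\<^sup>2" by (simp add: sum_power2_gt_zero_iff)
      then have "l\<^sup>2 * (p\<^sup>2 + q\<^sup>2) = (norm r)\<^sup>2" using False by (auto simp: l_def power_divide)
      then show ?thesis using False
        by (auto simp: x1_def x2_def power_mult_distrib distrib_left)
    qed (simp add: x1_def x2_def)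
    have proj: "\<bar>p * a + q * b\<bar> \<le> \<bar>x1 * a + x2 * b\<bar>" for a b
    proof (cases "p = 0 \<and> q = 0")
      case False
      then have pos: "0 < p\<^sup>2 + q\<^sup>2" by (simp add: sum_power2_gt_zero_iff)
      then have "sqrt (p\<^sup>2 + q\<^sup>2) \<le> norm r" using pq by (simp add: real_le_lsqrt)
      then have "1 \<le> l" using pos False by (simp add: l_def)
      have "x1 * a + x2 * b = l * (p * a + q * b)" using False by (auto simp: x1_def x2_def algebra_simps)
      then have "\<bar>x1 * a + x2 * b\<bar> = l * \<bar>p * a + q * b\<bar>" using \<open>1 \<le> l\<close> by (simp add: abs_mult)
      then show ?thesis using mult_right_mono[OF \<open>1 \<le> l\<close>, of "\<bar>p * a + q * b\<bar>"] by simp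
    qed simp
    have pair: "F s + F (- s) \<le> G s + G (- s)" for s
    proof (cases s)
      case (Pair a b)
      define A t u where "A = (norm r)\<^sup>2 + a\<^sup>2 + b\<^sup>2"
        and "t = 2 * (p * a + q * b)" and "u = 2 * (x1 * a + x2 * b)"
      have nF: "norm (r + (\<sigma> *\<^sub>R e1 + \<tau> *\<^sub>R e2)) = sqrt ((norm r)\<^sup>2 + \<sigma>\<^sup>2 + \<tau>\<^sup>2 + 2 * (p * \<sigma> + q * \<tau>))" for \<sigma> \<tau>
        unfolding norm_eq_sqrt_inner[of "r + _"]
        by (simp only: power2_norm_eq_inner inner_add_left inner_add_right inner_scaleR_left inner_scaleR_right
            e' p_def q_def inner_commute[of e1 r] inner_commute[of e2 r]) (simp add: power2_eq_square algebra_simps)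
      have nG: "(x1 + \<sigma>)\<^sup>2 + (x2 + \<tau>)\<^sup>2 = (norm r)\<^sup>2 + \<sigma>\<^sup>2 + \<tau>\<^sup>2 + 2 * (x1 * \<sigma> + x2 * \<tau>)" for \<sigma> \<tau>
        unfolding x[symmetric] by (simp add: power2_eq_square algebra_simps)
      have Gs: "(x1 + a)\<^sup>2 + (x2 + b)\<^sup>2 = A + u" "(x1 + - a)\<^sup>2 + (x2 + - b)\<^sup>2 = A - u"
        unfolding nG A_def u_def by (simp_all add: algebra_simps)
      have Fs: "norm (r + (a *\<^sub>R e1 + b *\<^sub>R e2)) = sqrt (A + t)"
        "norm (r + ((- a) *\<^sub>R e1 + (- b) *\<^sub>R e2)) = sqrt (A - t)"
        unfolding nF A_def t_def by (simp_all add: algebra_simps)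
      have "0 \<le> A + u" "0 \<le> A - u" unfolding Gs[symmetric] by simp_all
      then have "\<bar>u\<bar> \<le> A" by linarith
      moreover have "\<bar>t\<bar> \<le> \<bar>u\<bar>" unfolding t_def u_def abs_mult[of 2] using proj[of a b] by simp
      ultimately have "1 / ennreal (sqrt (A + t)) + 1 / ennreal (sqrt (A - t))
        \<le> 1 / ennreal (sqrt (A + u)) + 1 / ennreal (sqrt (A - u))"
        by (intro inverse_sqrt_pair_mono)
      then show ?thesis
        unfolding Pair F_def G_def uminus_prod_def fst_conv snd_conv prod.case Fs Gs by simp
    qed
    have "(\<integral>\<^sup>+s. F s \<partial>planar_cauchy) + (\<integral>\<^sup>+s. F s \<partial>planar_cauchy)
        = (\<integral>\<^sup>+s. F s + F (- s) \<partial>planar_cauchy)"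
      by (simp add: nn_integral_add nn_integral_planar_cauchy_uminus)
    also have "\<dots> \<le> (\<integral>\<^sup>+s. G s + G (- s) \<partial>planar_cauchy)"
      by (intro nn_integral_mono pair)
    also have "\<dots> = (\<integral>\<^sup>+s. G s \<partial>planar_cauchy) + (\<integral>\<^sup>+s. G s \<partial>planar_cauchy)"
      by (simp add: nn_integral_add nn_integral_planar_cauchy_uminus)
    finally have "(\<integral>\<^sup>+s. F s \<partial>planar_cauchy) \<le> (\<integral>\<^sup>+s. G s \<partial>planar_cauchy)"
      by (simp flip: mult_2 add: ennreal_mult_le_mult_iff)
    also have "\<dots> = ennreal (1 / sqrt (1 + x1\<^sup>2 + x2\<^sup>2))"
      unfolding G_def by (rule planar_cauchy_potential)
    also have "\<dots> = ennreal (1 / sqrt (1 + (norm r)\<^sup>2))"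
      by (simp add: x add.assoc)
    also have "\<dots> = 1 / ennreal (sqrt (1 + (norm r)\<^sup>2))"
      using divide_ennreal[of 1 "sqrt (1 + (norm r)\<^sup>2)"] by (simp add: add_pos_nonneg)
    finally show ?thesis by (simp add: F_def)
  qed
  show ?thesis
  proof (cases "c = 0")
    case True
    then show ?thesis by (simp add: case_prod_unfold emeasure_planar_cauchy_UNIV)
  next
    case False
    then have c: "0 < c" using assms by simp
    have "norm (r + c *\<^sub>R (a *\<^sub>R e1 + b *\<^sub>R e2)) = c * norm ((1 / c) *\<^sub>R r + (a *\<^sub>R e1 + b *\<^sub>R e2))" for a b
    proof -
      have "r + c *\<^sub>R (a *\<^sub>R e1 + b *\<^sub>R e2) = c *\<^sub>R ((1 / c) *\<^sub>R r + (a *\<^sub>R e1 + b *\<^sub>R e2))"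
        using c by (simp add: scaleR_add_right)
      then show ?thesis using c by simp
    qed
    then have "1 / ennreal (norm (r + c *\<^sub>R (a *\<^sub>R e1 + b *\<^sub>R e2)))
      = ennreal (inverse c) * (1 / ennreal (norm ((1 / c) *\<^sub>R r + (a *\<^sub>R e1 + b *\<^sub>R e2))))" for a b
      using c by (simp add: ennreal_mult' divide_ennreal_def ennreal_inverse_mult inverse_ennreal)
    moreover have "(\<lambda>(a, b). 1 / ennreal (norm ((1 / c) *\<^sub>R r + (a *\<^sub>R e1 + b *\<^sub>R e2)))) \<in> borel_measurable borel"
      by (subst borel_prod[symmetric]) measurable
    ultimately have "(\<integral>\<^sup>+(a, b). 1 / ennreal (norm (r + c *\<^sub>R (a *\<^sub>R e1 + b *\<^sub>R e2))) \<partial>planar_cauchy)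
      = ennreal (inverse c) * (\<integral>\<^sup>+(a, b). (1 / ennreal (norm ((1 / c) *\<^sub>R r + (a *\<^sub>R e1 + b *\<^sub>R e2)))) \<partial>planar_cauchy)"
      by (simp add: case_prod_unfold nn_integral_cmult)
    also have "\<dots> \<le> ennreal (inverse c) * (1 / ennreal (sqrt (1 + (norm ((1 / c) *\<^sub>R r))\<^sup>2)))"
      by (intro mult_left_mono unit) simp
    also have "\<dots> = 1 / ennreal (sqrt (c\<^sup>2 + (norm r)\<^sup>2))"
    proof -
      have "c\<^sup>2 + (norm r)\<^sup>2 = c\<^sup>2 * (1 + (norm ((1 / c) *\<^sub>R r))\<^sup>2)"
        using c by (simp add: power_divide distrib_left)
      then have "sqrt (c\<^sup>2 + (norm r)\<^sup>2) = c * sqrt (1 + (norm ((1 / c) *\<^sub>R r))\<^sup>2)"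
        using c by (simp add: real_sqrt_mult)
      then show ?thesis
        using c by (simp add: ennreal_mult' divide_ennreal_def ennreal_inverse_mult inverse_ennreal)
    qed
    finally show ?thesis .
  qed
qed

section \<open>Lower integrals\<close>

text \<open>
  The velocity of a curve is a junk value where the curve is not differentiable, so the kinetic
  energy is not known to be measurable. For nonmeasurable integrands \<open>\<integral>\<^sup>+\<close> is a lower integral: it is
  superadditive, and additive in measurable summands.
\<close>

lemma nn_integral_measurable_minorant:
  "\<exists>h \<in> borel_measurable M. (\<forall>x. h x \<le> f x) \<and> (\<integral>\<^sup>+x. h x \<partial>M) = (\<integral>\<^sup>+x. f x \<partial>M)"
proof -
  let ?S = "{g. simple_function M g \<and> g \<le> f}"
  have "integral\<^sup>S M ` ?S \<noteq> {}" by (auto intro!: exI[of _ "\<lambda>_. 0"] simp: le_fun_def)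
  \<comment> \<open>A sequence of simple minorants already realizes the supremum of the integrals,
    and its pointwise supremum is measurable.\<close>
  from ennreal_Sup_countable_SUP[OF this] obtain I :: "nat \<Rightarrow> ennreal"
    where I: "range I \<subseteq> integral\<^sup>S M ` ?S" "Sup (integral\<^sup>S M ` ?S) = (SUP n. I n)" by blast
  have "\<exists>g. simple_function M g \<and> g \<le> f \<and> I n = integral\<^sup>S M g" for n
    using I(1) by (fastforce simp: subset_eq)
  then obtain g where g: "\<And>n. simple_function M (g n)" "\<And>n. g n \<le> f" "\<And>n. I n = integral\<^sup>S M (g n)"
    by metis
  define h where "h x = (SUP n. g n x)" for x
  have [measurable]: "h \<in> borel_measurable M"
    unfolding h_def by (intro borel_measurable_SUP borel_measurable_simple_function g(1)) simp
  have le: "h x \<le> f x" for x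
    unfolding h_def using g(2) by (auto intro!: SUP_least simp: le_fun_def)
  have "(\<integral>\<^sup>+x. f x \<partial>M) = (SUP n. I n)" unfolding nn_integral_def using I(2) by simp
  also have "\<dots> \<le> (\<integral>\<^sup>+x. h x \<partial>M)"
    unfolding g(3) nn_integral_eq_simple_integral[OF g(1), symmetric]
    by (intro SUP_least nn_integral_mono) (auto simp: h_def intro: SUP_upper)
  finally have "(\<integral>\<^sup>+x. h x \<partial>M) = (\<integral>\<^sup>+x. f x \<partial>M)"
    using nn_integral_mono[of M h f, OF le] by (intro antisym)
  then show ?thesis using \<open>h \<in> borel_measurable M\<close> le by blast
qed

lemma nn_integral_superadditive:
  "(\<integral>\<^sup>+x. f x \<partial>M) + (\<integral>\<^sup>+x. g x \<partial>M) \<le> (\<integral>\<^sup>+x. f x + g x \<partial>M)"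
proof -
  obtain f' where f': "f' \<in> borel_measurable M" "\<And>x. f' x \<le> f x" "(\<integral>\<^sup>+x. f' x \<partial>M) = (\<integral>\<^sup>+x. f x \<partial>M)"
    using nn_integral_measurable_minorant[of M f] by blast
  obtain g' where g': "g' \<in> borel_measurable M" "\<And>x. g' x \<le> g x" "(\<integral>\<^sup>+x. g' x \<partial>M) = (\<integral>\<^sup>+x. g x \<partial>M)"
    using nn_integral_measurable_minorant[of M g] by blast
  have "(\<integral>\<^sup>+x. f x \<partial>M) + (\<integral>\<^sup>+x. g x \<partial>M) = (\<integral>\<^sup>+x. f' x + g' x \<partial>M)"
    using f' g' by (simp add: nn_integral_add)
  also have "\<dots> \<le> (\<integral>\<^sup>+x. f x + g x \<partial>M)"
    by (intro nn_integral_mono add_mono f' g')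
  finally show ?thesis .
qed

text \<open>A measurable minorant \<open>h\<close> of the sum yields the measurable minorant
  \<open>h - g\<close> of \<open>f\<close>.\<close>

lemma nn_integral_add_measurable_le:
  assumes [measurable]: "g \<in> borel_measurable M"
  shows "(\<integral>\<^sup>+x. f x + g x \<partial>M) \<le> (\<integral>\<^sup>+x. f x \<partial>M) + (\<integral>\<^sup>+x. g x \<partial>M)"
proof -
  obtain h where [measurable]: "h \<in> borel_measurable M" and h: "\<And>x. h x \<le> f x + g x"
      "(\<integral>\<^sup>+x. h x \<partial>M) = (\<integral>\<^sup>+x. f x + g x \<partial>M)"
    using nn_integral_measurable_minorant[of M "\<lambda>x. f x + g x"] by blast
  \<comment> \<open>Where \<open>g\<close> is infinite, 0 is a minorant of \<open>f\<close> and
    \<open>h \<le> k + g\<close> holds trivially.\<close>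
  define k where "k x = (if g x = \<infinity> then 0 else h x - g x)" for x
  have [measurable]: "k \<in> borel_measurable M" unfolding k_def by measurable
  have "k x \<le> f x" for x
    using h(1)[of x] by (auto simp: k_def ennreal_minus_le_iff add.commute)
  then have "(\<integral>\<^sup>+x. k x \<partial>M) \<le> (\<integral>\<^sup>+x. f x \<partial>M)" by (rule nn_integral_mono)
  moreover have "h x \<le> k x + g x" for x
    using ennreal_minus_le_iff[of "h x" "g x" "h x - g x"] by (auto simp: k_def add.commute)
  then have "(\<integral>\<^sup>+x. h x \<partial>M) \<le> (\<integral>\<^sup>+x. k x + g x \<partial>M)" by (rule nn_integral_mono)
  ultimately show ?thesis
    unfolding h(2) by (simp add: nn_integral_add) (meson add_right_mono order_trans)
qed

text \<open>Half of a measurable minorant of \<open>2 * f\<close> is a minorant of \<open>f\<close>;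
  this stands in for measurability of \<open>f\<close>.\<close>

lemma nn_integral_double_le:
  fixes f :: "'a \<Rightarrow> ennreal"
  shows "(\<integral>\<^sup>+x. 2 * f x \<partial>M) \<le> 2 * (\<integral>\<^sup>+x. f x \<partial>M)"
proof -
  obtain h where [measurable]: "h \<in> borel_measurable M" and h: "\<And>x. h x \<le> 2 * f x"
      "(\<integral>\<^sup>+x. h x \<partial>M) = (\<integral>\<^sup>+x. 2 * f x \<partial>M)"
    using nn_integral_measurable_minorant[of M "\<lambda>x. 2 * f x"] by blast
  have half: "2 * (h x / 2) = h x" for x
    using mult_divide_eq_ennreal[of 2 "h x"] by (simp add: ennreal_times_divide mult.commute)
  have "h x / 2 \<le> f x" for x
    using h(1)[of x] by (simp add: divide_le_posI_ennreal)
  then have "(\<integral>\<^sup>+x. h x / 2 \<partial>M) \<le> (\<integral>\<^sup>+x. f x \<partial>M)" by (rule nn_integral_mono)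
  then have "2 * (\<integral>\<^sup>+x. h x / 2 \<partial>M) \<le> 2 * (\<integral>\<^sup>+x. f x \<partial>M)" by (intro mult_left_mono) auto
  moreover have "(\<integral>\<^sup>+x. h x \<partial>M) = 2 * (\<integral>\<^sup>+x. h x / 2 \<partial>M)"
    by (subst nn_integral_cmult[symmetric]) (simp_all add: half)
  ultimately show ?thesis unfolding h(2) by simp
qed

section \<open>Absolutely continuous curves\<close>

text \<open>Makes the comparison curves admissible: a minimizer plus a Lipschitz displacement, or a
  bump plus a straight segment.\<close>

lemma abs_continuous_on_add_Lipschitz:
  fixes f g :: "real \<Rightarrow> 'b::real_normed_vector"
  assumes f: "abs_continuous_on S f"
    and g: "\<And>s t. s \<le> t \<Longrightarrow> norm (g t - g s) \<le> K * (t - s)"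
  shows "abs_continuous_on S (\<lambda>t. f t + g t)"
  unfolding abs_continuous_on_def
proof (intro allI impI)
  fix \<epsilon> :: real assume "\<epsilon> > 0"
  then obtain \<delta> where "\<delta> > 0" and \<delta>: "\<And>P. finite P \<Longrightarrow> (\<forall>(s, t)\<in>P. s \<le> t \<and> {s..t} \<subseteq> S) \<Longrightarrow>
        disjoint_family_on (\<lambda>(s, t). {s<..<t}) P \<Longrightarrow> (\<Sum>(s, t)\<in>P. t - s) < \<delta> \<Longrightarrow>
        (\<Sum>(s, t)\<in>P. norm (f t - f s)) < \<epsilon> / 2"
    using f[unfolded abs_continuous_on_def, rule_format, of "\<epsilon> / 2"] by auto
  have "0 \<le> K" using g[of 0 1] order_trans[OF norm_ge_zero] by fastforce
  show "\<exists>\<delta>>0. \<forall>P. finite P \<and> (\<forall>(s, t)\<in>P. s \<le> t \<and> {s..t} \<subseteq> S) \<and>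
        disjoint_family_on (\<lambda>(s, t). {s<..<t}) P \<and> (\<Sum>(s, t)\<in>P. t - s) < \<delta>
      \<longrightarrow> (\<Sum>(s, t)\<in>P. norm (f t + g t - (f s + g s))) < \<epsilon>"
  proof (intro exI[of _ "min \<delta> (\<epsilon> / (2 * (K + 1)))"] conjI allI impI)
    show "0 < min \<delta> (\<epsilon> / (2 * (K + 1)))" using \<open>\<delta> > 0\<close> \<open>\<epsilon> > 0\<close> \<open>0 \<le> K\<close> by simp
    fix P :: "(real \<times> real) set"
    assume P: "finite P \<and> (\<forall>(s, t)\<in>P. s \<le> t \<and> {s..t} \<subseteq> S) \<and>
        disjoint_family_on (\<lambda>(s, t). {s<..<t}) P \<and> (\<Sum>(s, t)\<in>P. t - s) < min \<delta> (\<epsilon> / (2 * (K + 1)))"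
    let ?l = "\<Sum>(s, t)\<in>P. t - s"
    have "0 \<le> ?l" using P by (auto intro!: sum_nonneg)
    have "(\<Sum>(s, t)\<in>P. norm (f t + g t - (f s + g s))) \<le> (\<Sum>(s, t)\<in>P. norm (f t - f s) + K * (t - s))"
    proof (intro sum_mono, clarify)
      fix s t assume "(s, t) \<in> P"
      then have "s \<le> t" using P by auto
      have "f t + g t - (f s + g s) = (f t - f s) + (g t - g s)" by simp
      then show "norm (f t + g t - (f s + g s)) \<le> norm (f t - f s) + K * (t - s)"
        using g[OF \<open>s \<le> t\<close>] norm_triangle_ineq[of "f t - f s" "g t - g s"] by (simp only:)
    qed
    also have "\<dots> = (\<Sum>(s, t)\<in>P. norm (f t - f s)) + K * ?l"
      by (simp add: case_prod_unfold sum.distrib sum_distrib_left)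
    also have "\<dots> < \<epsilon> / 2 + \<epsilon> / 2"
    proof (intro add_less_le_mono)
      show "(\<Sum>(s, t)\<in>P. norm (f t - f s)) < \<epsilon> / 2" using P by (intro \<delta>) auto
      have "K * ?l \<le> (K + 1) * ?l" using \<open>0 \<le> ?l\<close> by (simp add: algebra_simps)
      also have "\<dots> \<le> (K + 1) * (\<epsilon> / (2 * (K + 1)))" using P \<open>0 \<le> K\<close> by (intro mult_left_mono) auto
      also have "\<dots> = \<epsilon> / 2" using \<open>0 \<le> K\<close> by (simp add: field_simps)
      finally show "K * ?l \<le> \<epsilon> / 2" .
    qed
    finally show "(\<Sum>(s, t)\<in>P. norm (f t + g t - (f s + g s))) < \<epsilon>" by simp
  qed
qed

lemma abs_continuous_on_imp_continuous_on_Icc: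
  fixes f :: "real \<Rightarrow> 'b::real_normed_vector"
  assumes f: "abs_continuous_on {a..b} f"
  shows "continuous_on {a..b} f"
  unfolding continuous_on_iff
proof (intro ballI allI impI)
  fix x \<epsilon> :: real assume x: "x \<in> {a..b}" and "\<epsilon> > 0"
  then obtain \<delta> where "\<delta> > 0" and \<delta>: "\<And>P. finite P \<Longrightarrow> (\<forall>(s, t)\<in>P. s \<le> t \<and> {s..t} \<subseteq> {a..b}) \<Longrightarrow>
        disjoint_family_on (\<lambda>(s, t). {s<..<t}) P \<Longrightarrow> (\<Sum>(s, t)\<in>P. t - s) < \<delta> \<Longrightarrow>
        (\<Sum>(s, t)\<in>P. norm (f t - f s)) < \<epsilon>"
    using f[unfolded abs_continuous_on_def, rule_format, of \<epsilon>] by auto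
  show "\<exists>d>0. \<forall>x'\<in>{a..b}. dist x' x < d \<longrightarrow> dist (f x') (f x) < \<epsilon>"
  proof (intro exI[of _ \<delta>] conjI ballI impI)
    fix y assume y: "y \<in> {a..b}" "dist y x < \<delta>"
    have "(\<Sum>(s, t)\<in>{(min x y, max x y)}. norm (f t - f s)) < \<epsilon>"
      using x y by (intro \<delta>) (auto simp: disjoint_family_on_def dist_real_def)
    then show "dist (f y) (f x) < \<epsilon>"
      by (auto simp: dist_norm min_def max_def norm_minus_commute split: if_splits)
  qed fact
qed

lemma sum_integral_nonoverlapping_le:
  fixes q :: "real \<Rightarrow> real"
  assumes P: "finite P" "\<forall>(s, t)\<in>P. s \<le> t \<and> {s..t} \<subseteq> {a..b}" "disjoint_family_on (\<lambda>(s, t). {s<..<t}) P"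
    and q: "q integrable_on {a..b}" "\<And>t. t \<in> {a..b} \<Longrightarrow> 0 \<le> q t"
  shows "(\<Sum>(s, t)\<in>P. integral {s..t} q) \<le> integral {a..b} q"
proof -
  have sub: "{fst p..snd p} \<subseteq> {a..b}" if "p \<in> P" for p
    using P(2) that by (auto simp: case_prod_unfold)
  have "(q has_integral (\<Sum>p\<in>P. integral {fst p..snd p} q)) (\<Union>p\<in>P. {fst p..snd p})"
  proof (rule has_integral_UN[OF P(1)])
    fix p assume "p \<in> P"
    then show "(q has_integral integral {fst p..snd p} q) {fst p..snd p}"
      by (intro integrable_integral integrable_on_subinterval[OF q(1)] sub)
  next
    show "pairwise (\<lambda>p p'. negligible ({fst p..snd p} \<inter> {fst p'..snd p'})) P"
    proof (intro pairwiseI)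
      fix p p' assume "p \<in> P" "p' \<in> P" "p \<noteq> p'"
      then have "{fst p<..<snd p} \<inter> {fst p'<..<snd p'} = {}"
        using P(3) by (auto simp: disjoint_family_on_def case_prod_unfold)
      \<comment> \<open>Intervals with disjoint interiors meet in endpoints only; a degenerate
        interval inside another one consists of its own endpoint.\<close>
      then have "{fst p..snd p} \<inter> {fst p'..snd p'} \<subseteq> {fst p, snd p, fst p', snd p'}"
        by (auto simp: disjoint_iff)
      then show "negligible ({fst p..snd p} \<inter> {fst p'..snd p'})"
        by (rule negligible_subset[rotated]) simp
    qed
  qed
  then have "(\<Sum>p\<in>P. integral {fst p..snd p} q) \<le> integral {a..b} q"
    by (rule has_integral_subset_le[rotated 1, OF _ integrable_integral[OF q(1)]])
       (intro ballI q(2), assumption, intro UN_least sub, assumption)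
  then show ?thesis by (simp add: case_prod_unfold)
qed

text \<open>The hypothesis holds as soon as \<open>f\<close> is the indefinite integral of a function whose square is at
  most \<open>q\<close>, since \<open>u \<le> K + u\<^sup>2 / K\<close>.\<close>

lemma abs_continuous_on_IccI:
  fixes f :: "real \<Rightarrow> 'b::real_normed_vector" and q :: "real \<Rightarrow> real"
  assumes q: "q integrable_on {a..b}" "\<And>t. t \<in> {a..b} \<Longrightarrow> 0 \<le> q t"
    and f: "\<And>s t K. a \<le> s \<Longrightarrow> s \<le> t \<Longrightarrow> t \<le> b \<Longrightarrow> 0 < K \<Longrightarrow>
      norm (f t - f s) \<le> K * (t - s) + integral {s..t} q / K"
  shows "abs_continuous_on {a..b} f"
  unfolding abs_continuous_on_def
proof (intro allI impI)
  fix \<epsilon> :: real assume "\<epsilon> > 0"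
  define J where "J = integral {a..b} q"
  have "0 \<le> J" unfolding J_def using q by (intro integral_nonneg) auto
  \<comment> \<open>With this choice \<open>J / K\<close> falls short of
    \<open>\<epsilon> / 2\<close> by exactly \<open>\<epsilon> / (2 * (J + 1))\<close>, while
    intervals of total length below \<open>\<epsilon> / (2 * K)\<close> contribute less than the
    other half.\<close>
  define K where "K = 2 * (J + 1) / \<epsilon>"
  have "0 < K" using \<open>0 \<le> J\<close> \<open>\<epsilon> > 0\<close> by (simp add: K_def)
  show "\<exists>\<delta>>0. \<forall>P. finite P \<and> (\<forall>(s, t)\<in>P. s \<le> t \<and> {s..t} \<subseteq> {a..b}) \<and>
        disjoint_family_on (\<lambda>(s, t). {s<..<t}) P \<and> (\<Sum>(s, t)\<in>P. t - s) < \<delta>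
      \<longrightarrow> (\<Sum>(s, t)\<in>P. norm (f t - f s)) < \<epsilon>"
  proof (intro exI[of _ "\<epsilon> / (2 * K)"] conjI allI impI)
    show "0 < \<epsilon> / (2 * K)" using \<open>0 < K\<close> \<open>\<epsilon> > 0\<close> by simp
    fix P :: "(real \<times> real) set"
    assume P: "finite P \<and> (\<forall>(s, t)\<in>P. s \<le> t \<and> {s..t} \<subseteq> {a..b}) \<and>
        disjoint_family_on (\<lambda>(s, t). {s<..<t}) P \<and> (\<Sum>(s, t)\<in>P. t - s) < \<epsilon> / (2 * K)"
    have "(\<Sum>(s, t)\<in>P. norm (f t - f s)) \<le> (\<Sum>(s, t)\<in>P. K * (t - s) + integral {s..t} q / K)"
    proof (intro sum_mono, clarify)
      fix s t assume "(s, t) \<in> P"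
      then have "s \<le> t" "{s..t} \<subseteq> {a..b}" using P by auto
      then show "norm (f t - f s) \<le> K * (t - s) + integral {s..t} q / K"
        using \<open>0 < K\<close> by (intro f) auto
    qed
    also have "\<dots> = K * (\<Sum>(s, t)\<in>P. t - s) + (\<Sum>(s, t)\<in>P. integral {s..t} q) / K"
      by (simp add: case_prod_unfold sum.distrib sum_distrib_left sum_divide_distrib)
    also have "\<dots> < K * (\<epsilon> / (2 * K)) + J / K + \<epsilon> / (2 * (J + 1))"
    proof -
      have "K * (\<Sum>(s, t)\<in>P. t - s) < K * (\<epsilon> / (2 * K))"
        using P \<open>0 < K\<close> by (intro mult_strict_left_mono) auto
      moreover have "(\<Sum>(s, t)\<in>P. integral {s..t} q) / K \<le> J / K"
        unfolding J_def using P q \<open>0 < K\<close> by (intro divide_right_mono sum_integral_nonoverlapping_le) auto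
      moreover have "0 < \<epsilon> / (2 * (J + 1))" using \<open>\<epsilon> > 0\<close> \<open>0 \<le> J\<close> by simp
      ultimately show ?thesis by linarith
    qed
    also have "\<dots> = \<epsilon>"
      using \<open>0 \<le> J\<close> \<open>\<epsilon> > 0\<close> \<open>0 < K\<close> by (simp add: K_def divide_simps) (simp add: algebra_simps)
    finally show "(\<Sum>(s, t)\<in>P. norm (f t - f s)) < \<epsilon>" .
  qed
qed

lemma abs_continuous_on_scaleR:
  fixes f :: "real \<Rightarrow> real" and w :: "'b::real_normed_vector"
  assumes f: "abs_continuous_on S f"
  shows "abs_continuous_on S (\<lambda>t. f t *\<^sub>R w)"
  unfolding abs_continuous_on_def
proof (intro allI impI)
  fix \<epsilon> :: real assume "\<epsilon> > 0"
  then have "0 < \<epsilon> / (norm w + 1)" by (simp add: add_nonneg_pos)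
  then obtain \<delta> where "\<delta> > 0" and \<delta>: "\<And>P. finite P \<Longrightarrow> (\<forall>(s, t)\<in>P. s \<le> t \<and> {s..t} \<subseteq> S) \<Longrightarrow>
        disjoint_family_on (\<lambda>(s, t). {s<..<t}) P \<Longrightarrow> (\<Sum>(s, t)\<in>P. t - s) < \<delta> \<Longrightarrow>
        (\<Sum>(s, t)\<in>P. norm (f t - f s)) < \<epsilon> / (norm w + 1)"
    using f[unfolded abs_continuous_on_def, rule_format, of "\<epsilon> / (norm w + 1)"] by auto
  show "\<exists>\<delta>>0. \<forall>P. finite P \<and> (\<forall>(s, t)\<in>P. s \<le> t \<and> {s..t} \<subseteq> S) \<and>
        disjoint_family_on (\<lambda>(s, t). {s<..<t}) P \<and> (\<Sum>(s, t)\<in>P. t - s) < \<delta>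
      \<longrightarrow> (\<Sum>(s, t)\<in>P. norm (f t *\<^sub>R w - f s *\<^sub>R w)) < \<epsilon>"
  proof (intro exI[of _ \<delta>] conjI allI impI \<open>\<delta> > 0\<close>)
    fix P :: "(real \<times> real) set"
    assume P: "finite P \<and> (\<forall>(s, t)\<in>P. s \<le> t \<and> {s..t} \<subseteq> S) \<and>
        disjoint_family_on (\<lambda>(s, t). {s<..<t}) P \<and> (\<Sum>(s, t)\<in>P. t - s) < \<delta>"
    have "(\<Sum>(s, t)\<in>P. norm (f t *\<^sub>R w - f s *\<^sub>R w)) = (\<Sum>(s, t)\<in>P. norm (f t - f s)) * norm w"
      by (simp add: case_prod_unfold sum_distrib_right flip: scaleR_diff_left)
    also have "\<dots> \<le> (\<Sum>(s, t)\<in>P. norm (f t - f s)) * (norm w + 1)"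
      by (intro mult_left_mono sum_nonneg) auto
    also have "\<dots> < \<epsilon>"
      using \<delta>[of P] P by (simp add: pos_less_divide_eq add_nonneg_pos)
    finally show "(\<Sum>(s, t)\<in>P. norm (f t *\<^sub>R w - f s *\<^sub>R w)) < \<epsilon>" .
  qed
qed

section \<open>Displacing a minimizer\<close>

definition kinetic_energy :: "('n::finite \<Rightarrow> real) \<Rightarrow> 'a::euclidean_space ^ 'n \<Rightarrow> real" where
  "kinetic_energy m v = 1/2 * (\<Sum>i\<in>UNIV. m i * (norm (v $ i))\<^sup>2)"

lemma lagrangian_eq: "lagrangian m x v = ennreal (kinetic_energy m v) + newton_potential m x"
  by (simp add: lagrangian_def kinetic_energy_def)

lemma kinetic_energy_nonneg:
  assumes "\<And>i. m i > 0"
  shows "0 \<le> kinetic_energy m v"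
  unfolding kinetic_energy_def using assms by (auto intro!: sum_nonneg mult_nonneg_nonneg simp: less_imp_le)

text \<open>Here the cross terms of the two opposite displacements cancel, leaving a cost quadratic
  in the displacement.\<close>

lemma kinetic_energy_parallelogram:
  "kinetic_energy m (v + w) + kinetic_energy m (v - w) = 2 * kinetic_energy m v + 2 * kinetic_energy m w"
proof -
  have "m i * (norm ((v + w) $ i))\<^sup>2 + m i * (norm ((v - w) $ i))\<^sup>2
      = 2 * (m i * (norm (v $ i))\<^sup>2) + 2 * (m i * (norm (w $ i))\<^sup>2)" for i
    by (simp add: power2_norm_eq_inner inner_add_left inner_add_right inner_diff_left inner_diff_right algebra_simps)
  then have "(\<Sum>i\<in>UNIV. m i * (norm ((v + w) $ i))\<^sup>2) + (\<Sum>i\<in>UNIV. m i * (norm ((v - w) $ i))\<^sup>2)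
      = 2 * (\<Sum>i\<in>UNIV. m i * (norm (v $ i))\<^sup>2) + 2 * (\<Sum>i\<in>UNIV. m i * (norm (w $ i))\<^sup>2)"
    unfolding sum.distrib[symmetric] sum_distrib_left by (intro sum.cong refl)
  then show ?thesis unfolding kinetic_energy_def by simp
qed

lemma kinetic_energy_scaleR: "kinetic_energy m (c *\<^sub>R v) = c\<^sup>2 * kinetic_energy m v"
  by (simp add: kinetic_energy_def power_mult_distrib sum_distrib_left mult_ac)

lemma borel_measurable_newton_potential [measurable]:
  fixes \<gamma> :: "real \<Rightarrow> 'a::euclidean_space ^ 'n::{finite,linorder}"
  assumes "continuous_on UNIV \<gamma>"
  shows "(\<lambda>t. newton_potential m (\<gamma> t)) \<in> borel_measurable borel"
proof -
  have "(\<lambda>t. norm (\<gamma> t $ i - \<gamma> t $ j)) \<in> borel_measurable borel" for i j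
    by (intro borel_measurable_continuous_onI continuous_intros assms)
  then show ?thesis unfolding newton_potential_def by measurable
qed

text \<open>For continuous curves this part of the action has a Borel integrand, which is not known
  of the kinetic part, so it can be split and averaged freely. \<open>lborel\<close> suits Tonelli
  and gives the same value as \<open>lebesgue\<close>.\<close>

definition potential_action ::
  "('n::{finite,linorder} \<Rightarrow> real) \<Rightarrow> real \<Rightarrow> real \<Rightarrow> (real \<Rightarrow> 'a::euclidean_space ^ 'n::_) \<Rightarrow> ennreal" where
  "potential_action m a b \<gamma> = (\<integral>\<^sup>+t. newton_potential m (\<gamma> t) * indicator {a..b} t \<partial>lborel)"

text \<open>Adding \<open>\<plusminus>\<psi> d\<close> to a curve perturbs its velocity by \<open>\<plusminus>\<psi>' d\<close> where it is differentiable; elsewhere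
  \<^const>\<open>vector_derivative\<close> is the same junk value for all three curves, so that the bound
  below needs no almost everywhere differentiability.\<close>

lemma kinetic_energy_displacement:
  fixes \<gamma> :: "real \<Rightarrow> 'a::euclidean_space ^ 'n::finite" and \<psi> :: "real \<Rightarrow> real"
  assumes m: "\<And>i. m i > 0" and t: "t \<in> {a<..<b}" and \<psi>: "(\<psi> has_real_derivative c) (at t)"
  shows "kinetic_energy m (vector_derivative (\<lambda>t. \<gamma> t + \<psi> t *\<^sub>R d) (at t within {a..b}))
       + kinetic_energy m (vector_derivative (\<lambda>t. \<gamma> t - \<psi> t *\<^sub>R d) (at t within {a..b}))
     \<le> 2 * kinetic_energy m (vector_derivative \<gamma> (at t within {a..b})) + 2 * c\<^sup>2 * kinetic_energy m d"
proof -
  have at: "at t within {a..b} = at t" using t by (simp add: at_within_Icc_at)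
  have d: "((\<lambda>t. \<psi> t *\<^sub>R d) has_vector_derivative c *\<^sub>R d) (at t)"
    using \<psi> by (auto intro!: derivative_eq_intros simp: has_real_derivative_iff_has_vector_derivative)
  show ?thesis
  proof (cases "\<exists>v. (\<gamma> has_vector_derivative v) (at t)")
    case True
    then obtain v where v: "(\<gamma> has_vector_derivative v) (at t)" ..
    from v d have "vector_derivative (\<lambda>t. \<gamma> t + \<psi> t *\<^sub>R d) (at t) = v + c *\<^sub>R d"
      "vector_derivative (\<lambda>t. \<gamma> t - \<psi> t *\<^sub>R d) (at t) = v - c *\<^sub>R d"
      by (auto intro!: vector_derivative_at derivative_intros)
    then show ?thesis
      using vector_derivative_at[OF v] kinetic_energy_parallelogram[of m v "c *\<^sub>R d"]
      by (simp add: at kinetic_energy_scaleR)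
  next
    case False
    have p: "\<not> ((\<lambda>t. \<gamma> t + \<psi> t *\<^sub>R d) has_vector_derivative v) (at t)" for v
    proof
      assume "((\<lambda>t. \<gamma> t + \<psi> t *\<^sub>R d) has_vector_derivative v) (at t)"
      from has_vector_derivative_diff[OF this d] show False using False by simp
    qed
    have n: "\<not> ((\<lambda>t. \<gamma> t - \<psi> t *\<^sub>R d) has_vector_derivative v) (at t)" for v
    proof
      assume "((\<lambda>t. \<gamma> t - \<psi> t *\<^sub>R d) has_vector_derivative v) (at t)"
      from has_vector_derivative_add[OF this d] show False using False by simp
    qed
    have "vector_derivative (\<lambda>t. \<gamma> t + \<psi> t *\<^sub>R d) (at t) = vector_derivative \<gamma> (at t)"
      "vector_derivative (\<lambda>t. \<gamma> t - \<psi> t *\<^sub>R d) (at t) = vector_derivative \<gamma> (at t)"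
      using False p n by (simp_all add: vector_derivative_def)
    then show ?thesis
      using kinetic_energy_nonneg[OF m, where v = d] by (simp add: at)
  qed
qed

text \<open>Both displaced curves keep the endpoints, so each has at least the action of
  \<open>\<gamma>\<close>. In the sum of the two inequalities the kinetic energy of
  \<open>\<gamma>\<close> occurs twice on either side and cancels, being finite.\<close>

lemma minimizer_displacement:
  fixes \<gamma> :: "real \<Rightarrow> 'a::euclidean_space ^ 'n::{finite,linorder}" and \<psi> \<psi>' :: "real \<Rightarrow> real"
  assumes m: "\<And>i. m i > 0" and "a < b"
    and ac: "abs_continuous_on {a..b} \<gamma>" and cont: "continuous_on UNIV \<gamma>"
    and minimal: "action m a b \<gamma> = action_potential m (\<gamma> a) (\<gamma> b)" and finite: "action m a b \<gamma> < \<infinity>"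
    and Lip: "\<And>s t. \<bar>\<psi> s - \<psi> t\<bar> \<le> K * \<bar>s - t\<bar>" and ends: "\<psi> a = 0" "\<psi> b = 0"
    and deriv: "AE t in lborel. t \<in> {a<..<b} \<longrightarrow> (\<psi> has_real_derivative \<psi>' t) (at t)"
    and [measurable]: "\<psi>' \<in> borel_measurable borel"
  shows "2 * potential_action m a b \<gamma>
    \<le> (\<integral>\<^sup>+t\<in>{a..b}. ennreal (2 * (\<psi>' t)\<^sup>2 * kinetic_energy m d) \<partial>lborel)
      + (potential_action m a b (\<lambda>t. \<gamma> t + \<psi> t *\<^sub>R d) + potential_action m a b (\<lambda>t. \<gamma> t - \<psi> t *\<^sub>R d))"
proof -
  define T where "T \<eta> t = ennreal (kinetic_energy m (vector_derivative \<eta> (at t within {a..b}))) * indicator {a..b} t"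
    for \<eta> :: "real \<Rightarrow> 'a ^ 'n::_" and t
  define V where "V \<eta> t = newton_potential m (\<eta> t) * indicator {a..b} t" for \<eta> :: "real \<Rightarrow> 'a ^ 'n::_" and t
  define C where "C t = ennreal (2 * (\<psi>' t)\<^sup>2 * kinetic_energy m d) * indicator {a..b} t" for t
  define \<gamma>p \<gamma>n where "\<gamma>p = (\<lambda>t. \<gamma> t + \<psi> t *\<^sub>R d)" and "\<gamma>n = (\<lambda>t. \<gamma> t - \<psi> t *\<^sub>R d)"
  have action: "action m a b \<eta> = (\<integral>\<^sup>+t. T \<eta> t + V \<eta> t \<partial>lborel)" for \<eta> :: "real \<Rightarrow> 'a ^ 'n::_"
    unfolding action_def T_def V_def lagrangian_eq nn_integral_completion by (simp add: distrib_right)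
  have potential: "potential_action m a b \<eta> = (\<integral>\<^sup>+t. V \<eta> t \<partial>lborel)" for \<eta> :: "real \<Rightarrow> 'a ^ 'n::_"
    unfolding potential_action_def V_def ..
  have le: "norm (\<psi> t *\<^sub>R d - \<psi> s *\<^sub>R d) \<le> (K * norm d) * (t - s)" if "s \<le> t" for s t
    using mult_right_mono[OF Lip[of t s] norm_ge_zero[of d]] that by (simp flip: scaleR_diff_left add: mult_ac)
  have cont_\<psi>: "continuous_on UNIV \<psi>"
  proof (rule lipschitz_on_continuous_on[of K])
    have "0 \<le> K" using Lip[of 0 1] by simp
    then show "K-lipschitz_on UNIV \<psi>" using Lip by (auto simp: lipschitz_on_def dist_real_def)
  qed
  have cont': "continuous_on UNIV \<gamma>p" "continuous_on UNIV \<gamma>n"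
    unfolding \<gamma>p_def \<gamma>n_def by (intro continuous_intros cont cont_\<psi>)+
  have [measurable]: "V \<gamma> \<in> borel_measurable borel" "V \<gamma>p \<in> borel_measurable borel" "V \<gamma>n \<in> borel_measurable borel"
    using borel_measurable_newton_potential[OF cont] borel_measurable_newton_potential[OF cont'(1)]
      borel_measurable_newton_potential[OF cont'(2)] unfolding V_def by measurable
  have [measurable]: "C \<in> borel_measurable borel" unfolding C_def by measurable
  have least: "action m a b \<gamma> \<le> action m a b \<eta>"
    if "abs_continuous_on {a..b} \<eta>" "\<eta> a = \<gamma> a" "\<eta> b = \<gamma> b" for \<eta>
    unfolding minimal action_potential_def using that \<open>a < b\<close> by (intro Inf_lower) blast
  have "abs_continuous_on {a..b} \<gamma>p" unfolding \<gamma>p_def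
    by (rule abs_continuous_on_add_Lipschitz[OF ac le])
  moreover have "abs_continuous_on {a..b} (\<lambda>t. \<gamma> t + - (\<psi> t *\<^sub>R d))"
    by (rule abs_continuous_on_add_Lipschitz[OF ac, where K = "K * norm d"]) (use le in \<open>simp add: norm_minus_commute\<close>)
  then have "abs_continuous_on {a..b} \<gamma>n" unfolding \<gamma>n_def by simp
  ultimately have "action m a b \<gamma> \<le> action m a b \<gamma>p" "action m a b \<gamma> \<le> action m a b \<gamma>n"
    by (auto intro!: least simp: \<gamma>p_def \<gamma>n_def ends)
  then have "2 * action m a b \<gamma> \<le> action m a b \<gamma>p + action m a b \<gamma>n"
    by (simp add: mult_2 add_mono)
  \<comment> \<open>Superadditivity has the right direction twice: here it bounds the competitors
    from above, later it bounds the action of \<open>\<gamma>\<close> from below.\<close>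
  also have "\<dots> \<le> (\<integral>\<^sup>+t. (T \<gamma>p t + V \<gamma>p t) + (T \<gamma>n t + V \<gamma>n t) \<partial>lborel)"
    unfolding action by (rule nn_integral_superadditive)
  also have "\<dots> \<le> (\<integral>\<^sup>+t. 2 * T \<gamma> t + (C t + (V \<gamma>p t + V \<gamma>n t)) \<partial>lborel)"
  proof (rule nn_integral_mono_AE)
    have kin: "T \<gamma>p t + T \<gamma>n t \<le> 2 * T \<gamma> t + C t"
      if t: "t \<noteq> a" "t \<noteq> b" and D: "t \<in> {a<..<b} \<longrightarrow> (\<psi> has_real_derivative \<psi>' t) (at t)" for t
    proof (cases "t \<in> {a<..<b}")
      case True
      then have "ennreal (kinetic_energy m (vector_derivative \<gamma>p (at t within {a..b})) + kinetic_energy m (vector_derivative \<gamma>n (at t within {a..b})))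
        \<le> ennreal (2 * kinetic_energy m (vector_derivative \<gamma> (at t within {a..b})) + 2 * (\<psi>' t)\<^sup>2 * kinetic_energy m d)"
        unfolding \<gamma>p_def \<gamma>n_def using D by (intro ennreal_leI kinetic_energy_displacement m) auto
      then show ?thesis
        using True by (simp add: T_def C_def kinetic_energy_nonneg[OF m] ennreal_mult)
    next
      case False
      then show ?thesis using t by (auto simp: T_def)
    qed
    have "(T \<gamma>p t + V \<gamma>p t) + (T \<gamma>n t + V \<gamma>n t) = (T \<gamma>p t + T \<gamma>n t) + (V \<gamma>p t + V \<gamma>n t)" for t
      by (simp add: ac_simps)
    then have "(T \<gamma>p t + V \<gamma>p t) + (T \<gamma>n t + V \<gamma>n t) \<le> 2 * T \<gamma> t + (C t + (V \<gamma>p t + V \<gamma>n t))"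
      if "t \<noteq> a" "t \<noteq> b" "t \<in> {a<..<b} \<longrightarrow> (\<psi> has_real_derivative \<psi>' t) (at t)" for t
      using add_right_mono[OF kin[OF that], of "V \<gamma>p t + V \<gamma>n t"] by (simp only: add.assoc)
    then show "AE t in lborel. (T \<gamma>p t + V \<gamma>p t) + (T \<gamma>n t + V \<gamma>n t) \<le> 2 * T \<gamma> t + (C t + (V \<gamma>p t + V \<gamma>n t))"
      using deriv AE_lborel_singleton[of a] AE_lborel_singleton[of b] by auto
  qed
  \<comment> \<open>The opposite direction needs one measurable summand. The pointwise estimate has
    left \<open>T \<gamma>\<close> as the only kinetic term, and all else is measurable.\<close>
  also have "\<dots> \<le> (\<integral>\<^sup>+t. 2 * T \<gamma> t \<partial>lborel) + (\<integral>\<^sup>+t. C t + (V \<gamma>p t + V \<gamma>n t) \<partial>lborel)"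
    by (rule nn_integral_add_measurable_le) measurable
  also have "\<dots> \<le> 2 * (\<integral>\<^sup>+t. T \<gamma> t \<partial>lborel) + (\<integral>\<^sup>+t. C t + (V \<gamma>p t + V \<gamma>n t) \<partial>lborel)"
    by (intro add_right_mono nn_integral_double_le)
  finally have "2 * action m a b \<gamma> \<le> 2 * (\<integral>\<^sup>+t. T \<gamma> t \<partial>lborel) + (\<integral>\<^sup>+t. C t + (V \<gamma>p t + V \<gamma>n t) \<partial>lborel)" .
  moreover have "2 * (\<integral>\<^sup>+t. T \<gamma> t \<partial>lborel) + 2 * (\<integral>\<^sup>+t. V \<gamma> t \<partial>lborel) \<le> 2 * action m a b \<gamma>"
    unfolding action distrib_left[symmetric] by (intro mult_left_mono nn_integral_superadditive) simp
  ultimately have "2 * (\<integral>\<^sup>+t. T \<gamma> t \<partial>lborel) + 2 * (\<integral>\<^sup>+t. V \<gamma> t \<partial>lborel)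
    \<le> 2 * (\<integral>\<^sup>+t. T \<gamma> t \<partial>lborel) + (\<integral>\<^sup>+t. C t + (V \<gamma>p t + V \<gamma>n t) \<partial>lborel)"
    by (rule order_trans[rotated])
  moreover have "2 * (\<integral>\<^sup>+t. T \<gamma> t \<partial>lborel) \<noteq> \<infinity>"
  proof -
    have "(\<integral>\<^sup>+t. T \<gamma> t \<partial>lborel) \<le> action m a b \<gamma>"
      unfolding action by (intro nn_integral_mono) simp
    then show ?thesis using finite by (auto simp: ennreal_mult_eq_top_iff top_unique)
  qed
  ultimately have "2 * (\<integral>\<^sup>+t. V \<gamma> t \<partial>lborel) \<le> (\<integral>\<^sup>+t. C t + (V \<gamma>p t + V \<gamma>n t) \<partial>lborel)"
    by (simp add: ennreal_add_left_cancel_le)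
  also have "\<dots> = (\<integral>\<^sup>+t. C t \<partial>lborel) + ((\<integral>\<^sup>+t. V \<gamma>p t \<partial>lborel) + (\<integral>\<^sup>+t. V \<gamma>n t \<partial>lborel))"
    by (simp add: nn_integral_add)
  finally show ?thesis unfolding potential \<gamma>p_def \<gamma>n_def C_def .
qed

section \<open>Averaging over displacements\<close>

lemma ennreal_divide_left_antimono:
  fixes x y z :: ennreal
  assumes "z \<le> y"
  shows "x / y \<le> x / z"
proof -
  have "inverse y \<le> inverse z" 
  proof (cases "z = 0 \<or> y = \<infinity>")
    case False
    then show ?thesis using assms
      by (cases y; cases z) (auto simp: inverse_ennreal ennreal_le_iff top_unique intro!: ennreal_leI le_imp_inverse_le)
  qed auto
  then show ?thesis unfolding divide_ennreal_def by (rule mult_left_mono) simp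
qed

text \<open>The Plummer potential. Softening at length \<open>\<rho>\<close> is the effect of
  averaging over Cauchy displacements of scale \<open>\<rho>\<close>.\<close>

definition softened_potential ::
  "('n::{finite,linorder} \<Rightarrow> real) \<Rightarrow> real \<Rightarrow> 'a::euclidean_space ^ 'n::_ \<Rightarrow> ennreal" where
  "softened_potential m \<rho> x =
    (\<Sum>(i, j) | i < j. ennreal (m i * m j) / ennreal (sqrt (\<rho>\<^sup>2 + (norm (x $ i - x $ j))\<^sup>2)))"

lemma softened_potential_le_newton_potential: "softened_potential m \<rho> x \<le> newton_potential m x"
  unfolding softened_potential_def newton_potential_def
  by (intro sum_mono) (auto intro!: ennreal_divide_left_antimono ennreal_leI real_le_rsqrt)

text \<open>Uniform in the configuration, collisions included. It yields the term of order
  \<open>L / \<sigma>\<close> in the growth inequality and, with \<open>\<rho> = bump t\<close>, the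
  finiteness of the action potential.\<close>

lemma softened_potential_le_const:
  fixes x :: "'a::euclidean_space ^ 'n::{finite,linorder}"
  assumes m: "\<And>i. m i > 0" and "0 < \<rho>"
  shows "softened_potential m \<rho> x \<le> ennreal ((\<Sum>(i, j) | i < j. m i * m j) / \<rho>)"
proof -
  have "softened_potential m \<rho> x \<le> (\<Sum>(i, j) | i < j. ennreal (m i * m j / \<rho>))"
    unfolding softened_potential_def
  proof (intro sum_mono, clarify)
    fix i j :: 'n
    have "\<rho> \<le> sqrt (\<rho>\<^sup>2 + (norm (x $ i - x $ j))\<^sup>2)" using assms by (simp add: real_le_rsqrt)
    then have "ennreal (m i * m j) / ennreal (sqrt (\<rho>\<^sup>2 + (norm (x $ i - x $ j))\<^sup>2)) \<le> ennreal (m i * m j) / ennreal \<rho>"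
      by (intro ennreal_divide_left_antimono ennreal_leI)
    also have "\<dots> = ennreal (m i * m j / \<rho>)"
      using m \<open>0 < \<rho>\<close> by (intro divide_ennreal) (auto simp: less_imp_le)
    finally show "ennreal (m i * m j) / ennreal (sqrt (\<rho>\<^sup>2 + (norm (x $ i - x $ j))\<^sup>2)) \<le> ennreal (m i * m j / \<rho>)" .
  qed
  also have "\<dots> = ennreal ((\<Sum>(i, j) | i < j. m i * m j) / \<rho>)"
    using m \<open>0 < \<rho>\<close> unfolding case_prod_unfold sum_divide_distrib
    by (intro sum_ennreal) (auto simp: less_imp_le)
  finally show ?thesis .
qed

text \<open>With \<open>q = sqrt (1 + r\<^sup>2)\<close> one has
  \<open>1 / r - 1 / q = 1 / (r * q * (q + r))\<close>, which decreases in \<open>r\<close>;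
  \<open>gap\<close> is its value at \<open>D\<close>. Softening can only lower the terms of the
  other pairs.\<close>

lemma softened_potential_gap:
  fixes x :: "'a::euclidean_space ^ 'n::{finite,linorder}"
  assumes m: "\<And>i. m i > 0" and "i < j" and D: "norm (x $ i - x $ j) \<le> D" "0 < D"
  defines "gap \<equiv> 1 / (D * sqrt (1 + D\<^sup>2) * (sqrt (1 + D\<^sup>2) + D))"
  shows "softened_potential m 1 x + ennreal (m i * m j * gap) \<le> newton_potential m x"
proof -
  define r where "r = norm (x $ i - x $ j)"
  define c where "c = m i * m j"
  have "0 < c" using m by (simp add: c_def)
  have rD: "0 \<le> r" "r \<le> D" using D by (simp_all add: r_def)
  have "0 \<le> gap" using D by (simp add: gap_def)
  have "ennreal c / ennreal (sqrt (1\<^sup>2 + r\<^sup>2)) + ennreal (c * gap) \<le> ennreal c / ennreal r"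
  proof (cases "r = 0")
    case True
    then show ?thesis using \<open>0 < c\<close> by (simp add: ennreal_divide_eq_top_iff ennreal_eq_0_iff)
  next
    case False
    then have r: "0 < r" using rD by simp
    define q where "q = sqrt (1 + r\<^sup>2)"
    have q: "0 < q" "q\<^sup>2 = 1 + r\<^sup>2" by (simp_all add: q_def add_pos_nonneg)
    have "1 / r - 1 / q = (q - r) / (r * q)"
      using r q(1) by (simp add: field_simps)
    also have "\<dots> = (q - r) * (q + r) / (r * q * (q + r))"
      using r q(1) by simp
    also have "(q - r) * (q + r) = 1" using q(2) by (simp add: power2_eq_square algebra_simps)
    finally have "1 / r - 1 / q = 1 / (r * q * (q + r))" .
    moreover have "gap \<le> 1 / (r * q * (q + r))"
      unfolding gap_def q_def using r rD
      by (intro divide_left_mono mult_mono add_mono real_sqrt_le_mono mult_pos_pos add_pos_pos add_left_mono power_mono)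
        (auto simp: add_pos_nonneg)
    ultimately have "1 / q + gap \<le> 1 / r" by simp
    then have "c * (1 / q + gap) \<le> c * (1 / r)" using \<open>0 < c\<close> by (intro mult_left_mono) auto
    then have "ennreal (c / q + c * gap) \<le> ennreal (c / r)" by (intro ennreal_leI) (simp add: distrib_left)
    then show ?thesis
      using r q(1) \<open>0 < c\<close> \<open>0 \<le> gap\<close> by (simp add: divide_ennreal q_def)
  qed
  \<comment> \<open>The removed \<open>(i, j)\<close> is the fixed pair; the summation variables
    shadow it.\<close>
  moreover have "(\<Sum>(i, j)\<in>{(i, j). i < j} - {(i, j)}. ennreal (m i * m j) / ennreal (sqrt (1\<^sup>2 + (norm (x $ i - x $ j))\<^sup>2)))
      \<le> (\<Sum>(i, j)\<in>{(i, j). i < j} - {(i, j)}. ennreal (m i * m j) / ennreal (norm (x $ i - x $ j)))"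
    by (intro sum_mono) (auto intro!: ennreal_divide_left_antimono ennreal_leI real_le_rsqrt)
  ultimately have "(ennreal c / ennreal (sqrt (1\<^sup>2 + r\<^sup>2)) + ennreal (c * gap))
      + (\<Sum>(i, j)\<in>{(i, j). i < j} - {(i, j)}. ennreal (m i * m j) / ennreal (sqrt (1\<^sup>2 + (norm (x $ i - x $ j))\<^sup>2)))
      \<le> ennreal c / ennreal r
      + (\<Sum>(i, j)\<in>{(i, j). i < j} - {(i, j)}. ennreal (m i * m j) / ennreal (norm (x $ i - x $ j)))"
    by (rule add_mono)
  moreover have "(i, j) \<in> {(i, j). i < j}" using \<open>i < j\<close> by simp
  ultimately show ?thesis
    unfolding softened_potential_def newton_potential_def
    by (simp add: sum.remove[of "{(i, j). i < j}" "(i, j)"] c_def r_def ac_simps)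
qed

definition spread_displacement ::
  "'a::euclidean_space \<Rightarrow> 'a \<Rightarrow> ('n::finite \<Rightarrow> nat) \<Rightarrow> real \<times> real \<Rightarrow> 'a ^ 'n" where
  "spread_displacement e1 e2 k s = (\<chi> i. real (k i) *\<^sub>R (fst s *\<^sub>R e1 + snd s *\<^sub>R e2))"

text \<open>The values of \<open>k\<close> are distinct integers, so bodies \<open>i\<close> and
  \<open>j\<close> move relative to each other by a multiple \<open>\<kappa>\<close> of the random
  vector with \<open>\<bar>\<kappa>\<bar> \<ge> \<bar>c\<bar>\<close>. Every pair is thus softened
  at length \<open>\<bar>c\<bar>\<close> or more.\<close>

lemma nn_integral_planar_cauchy_newton_potential_le:
  fixes x :: "'a::euclidean_space ^ 'n::{finite,linorder}"
  assumes e: "e1 \<in> Basis" "e2 \<in> Basis" "e1 \<noteq> e2" and k: "inj k"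
  shows "(\<integral>\<^sup>+s. newton_potential m (x + c *\<^sub>R spread_displacement e1 e2 k s) \<partial>planar_cauchy)
    \<le> softened_potential m c x"
proof -
  have pair: "(\<integral>\<^sup>+s. A / ennreal (norm ((x + c *\<^sub>R spread_displacement e1 e2 k s) $ i
        - (x + c *\<^sub>R spread_displacement e1 e2 k s) $ j)) \<partial>planar_cauchy)
      \<le> A / ennreal (sqrt (c\<^sup>2 + (norm (x $ i - x $ j))\<^sup>2))" if "i < j" for i j A
  proof -
    define \<kappa> where "\<kappa> = c * (real (k i) - real (k j))"
    define r where "r = x $ i - x $ j"
    \<comment> \<open>The estimate for the inverse norm wants a nonnegative factor; negating the
      whole vector moves the sign of \<open>\<kappa>\<close> to \<open>r\<close>.\<close>
    define \<sigma> :: real where "\<sigma> = (if \<kappa> < 0 then -1 else 1)"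
    have norm_eq: "norm ((x + c *\<^sub>R spread_displacement e1 e2 k s) $ i - (x + c *\<^sub>R spread_displacement e1 e2 k s) $ j)
        = norm (\<sigma> *\<^sub>R r + \<bar>\<kappa>\<bar> *\<^sub>R (fst s *\<^sub>R e1 + snd s *\<^sub>R e2))" for s
    proof -
      define v where "v = fst s *\<^sub>R e1 + snd s *\<^sub>R e2"
      have "(x + c *\<^sub>R spread_displacement e1 e2 k s) $ i - (x + c *\<^sub>R spread_displacement e1 e2 k s) $ j = r + \<kappa> *\<^sub>R v"
        by (simp add: spread_displacement_def r_def \<kappa>_def v_def scaleR_diff_left right_diff_distrib)
      also have "\<dots> = \<sigma> *\<^sub>R (\<sigma> *\<^sub>R r + \<bar>\<kappa>\<bar> *\<^sub>R v)"
        by (auto simp: \<sigma>_def)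
      also have "norm \<dots> = norm (\<sigma> *\<^sub>R r + \<bar>\<kappa>\<bar> *\<^sub>R v)" by (auto simp: \<sigma>_def)
      finally show ?thesis by (simp add: v_def)
    qed
    have "(\<lambda>(a, b). 1 / ennreal (norm (\<sigma> *\<^sub>R r + \<bar>\<kappa>\<bar> *\<^sub>R (a *\<^sub>R e1 + b *\<^sub>R e2)))) \<in> borel_measurable borel"
      by (subst borel_prod[symmetric]) measurable
    then have [measurable]: "(\<lambda>s. 1 / ennreal (norm (\<sigma> *\<^sub>R r + \<bar>\<kappa>\<bar> *\<^sub>R (fst s *\<^sub>R e1 + snd s *\<^sub>R e2)))) \<in> borel_measurable borel"
      by (simp add: case_prod_unfold)
    have div: "A / y = A * (1 / y)" for y by (simp add: ennreal_times_divide)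
    have "(\<integral>\<^sup>+s. A / ennreal (norm ((x + c *\<^sub>R spread_displacement e1 e2 k s) $ i
        - (x + c *\<^sub>R spread_displacement e1 e2 k s) $ j)) \<partial>planar_cauchy)
      = A * (\<integral>\<^sup>+s. 1 / ennreal (norm (\<sigma> *\<^sub>R r + \<bar>\<kappa>\<bar> *\<^sub>R (fst s *\<^sub>R e1 + snd s *\<^sub>R e2))) \<partial>planar_cauchy)"
      unfolding norm_eq div[of "ennreal (norm _)"] by (rule nn_integral_cmult) measurable
    also have "\<dots> \<le> A * (1 / ennreal (sqrt (\<bar>\<kappa>\<bar>\<^sup>2 + (norm (\<sigma> *\<^sub>R r))\<^sup>2)))"
      using nn_integral_planar_cauchy_inverse_norm_le[OF e, of "\<bar>\<kappa>\<bar>" "\<sigma> *\<^sub>R r"]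
      by (intro mult_left_mono) (simp_all add: case_prod_unfold)
    also have "\<dots> = A / ennreal (sqrt (\<kappa>\<^sup>2 + (norm r)\<^sup>2))"
      by (simp add: ennreal_times_divide \<sigma>_def)
    also have "\<dots> \<le> A / ennreal (sqrt (c\<^sup>2 + (norm r)\<^sup>2))"
    proof -
      have "k i \<noteq> k j" using \<open>i < j\<close> k by (metis injD less_irrefl)
      then have "1 \<le> \<bar>real (k i) - real (k j)\<bar>" by linarith
      then have "1 \<le> (real (k i) - real (k j))\<^sup>2" by (metis one_le_power power2_abs)
      then have "c\<^sup>2 * 1 \<le> c\<^sup>2 * (real (k i) - real (k j))\<^sup>2" by (intro mult_left_mono) auto
      then have "c\<^sup>2 \<le> \<kappa>\<^sup>2" by (simp add: \<kappa>_def power_mult_distrib)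
      then show ?thesis by (intro ennreal_divide_left_antimono ennreal_leI real_sqrt_le_mono) simp
    qed
    finally show ?thesis by (simp add: r_def)
  qed
  have [measurable]: "(\<lambda>s. norm ((x + c *\<^sub>R spread_displacement e1 e2 k s) $ i
        - (x + c *\<^sub>R spread_displacement e1 e2 k s) $ j)) \<in> borel_measurable borel" for i j
    unfolding spread_displacement_def by (intro borel_measurable_continuous_onI) (auto intro!: continuous_intros)
  show ?thesis
    unfolding newton_potential_def softened_potential_def case_prod_unfold
  proof (subst nn_integral_sum)
    show "(\<Sum>p\<in>{p. fst p < snd p}. \<integral>\<^sup>+s. ennreal (m (fst p) * m (snd p)) /
        ennreal (norm ((x + c *\<^sub>R spread_displacement e1 e2 k s) $ fst p
          - (x + c *\<^sub>R spread_displacement e1 e2 k s) $ snd p)) \<partial>planar_cauchy)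
      \<le> (\<Sum>p\<in>{p. fst p < snd p}. ennreal (m (fst p) * m (snd p)) /
        ennreal (sqrt (c\<^sup>2 + (norm (x $ fst p - x $ snd p))\<^sup>2)))"
      by (intro sum_mono pair) simp
  qed measurable
qed

text \<open>Tonelli reduces the mean of the time integral to the pointwise estimate, with
  \<open>f t\<close> as the softening length at time \<open>t\<close>.\<close>

lemma planar_cauchy_average_potential_action_le:
  fixes \<gamma> :: "real \<Rightarrow> 'a::euclidean_space ^ 'n::{finite,linorder}"
  assumes e: "e1 \<in> Basis" "e2 \<in> Basis" "e1 \<noteq> e2" and k: "inj k"
    and cont: "continuous_on UNIV \<gamma>" "continuous_on UNIV f"
  shows "(\<integral>\<^sup>+s. potential_action m a b (\<lambda>t. \<gamma> t + f t *\<^sub>R spread_displacement e1 e2 k s) \<partial>planar_cauchy)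
    \<le> (\<integral>\<^sup>+t\<in>{a..b}. softened_potential m (f t) (\<gamma> t) \<partial>lborel)"
    and "(\<lambda>s. potential_action m a b (\<lambda>t. \<gamma> t + f t *\<^sub>R spread_displacement e1 e2 k s)) \<in> borel_measurable borel"
proof -
  interpret pair_sigma_finite planar_cauchy lborel ..
  define g where "g s t = newton_potential m (\<gamma> t + f t *\<^sub>R spread_displacement e1 e2 k s) * indicator {a..b} t" for s t
  have [measurable]: "(\<lambda>(s, t). g s t) \<in> borel_measurable (borel \<Otimes>\<^sub>M borel)"
  proof -
    have "continuous_on UNIV (\<lambda>p::(real \<times> real) \<times> real. \<gamma> (snd p))"
      by (rule continuous_on_compose2[OF cont(1)]) (auto intro!: continuous_intros)
    moreover have "continuous_on UNIV (\<lambda>p::(real \<times> real) \<times> real. f (snd p))"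
      by (rule continuous_on_compose2[OF cont(2)]) (auto intro!: continuous_intros)
    ultimately have "(\<lambda>p. norm ((\<gamma> (snd p) + f (snd p) *\<^sub>R spread_displacement e1 e2 k (fst p)) $ i
        - (\<gamma> (snd p) + f (snd p) *\<^sub>R spread_displacement e1 e2 k (fst p)) $ j)) \<in> borel_measurable borel" for i j
      unfolding spread_displacement_def by (intro borel_measurable_continuous_onI) (auto intro!: continuous_intros)
    then have [measurable]: "(\<lambda>p. norm ((\<gamma> (snd p) + f (snd p) *\<^sub>R spread_displacement e1 e2 k (fst p)) $ i
        - (\<gamma> (snd p) + f (snd p) *\<^sub>R spread_displacement e1 e2 k (fst p)) $ j)) \<in> borel_measurable (borel \<Otimes>\<^sub>M borel)" for i j
      by (simp add: borel_prod)
    show ?thesis unfolding g_def newton_potential_def case_prod_unfold by measurable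
  qed
  have pot: "potential_action m a b (\<lambda>t. \<gamma> t + f t *\<^sub>R spread_displacement e1 e2 k s) = (\<integral>\<^sup>+t. g s t \<partial>lborel)" for s
    unfolding potential_action_def g_def ..
  show "(\<lambda>s. potential_action m a b (\<lambda>t. \<gamma> t + f t *\<^sub>R spread_displacement e1 e2 k s)) \<in> borel_measurable borel"
    unfolding pot by measurable
  have "(\<integral>\<^sup>+s. potential_action m a b (\<lambda>t. \<gamma> t + f t *\<^sub>R spread_displacement e1 e2 k s) \<partial>planar_cauchy)
      = (\<integral>\<^sup>+t. \<integral>\<^sup>+s. g s t \<partial>planar_cauchy \<partial>lborel)"
    unfolding pot by (rule Fubini'[symmetric]) measurable
  also have "\<dots> \<le> (\<integral>\<^sup>+t\<in>{a..b}. softened_potential m (f t) (\<gamma> t) \<partial>lborel)"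
    using nn_integral_planar_cauchy_newton_potential_le[OF e k]
    by (intro nn_integral_mono) (auto simp: g_def split: split_indicator)
  finally show "(\<integral>\<^sup>+s. potential_action m a b (\<lambda>t. \<gamma> t + f t *\<^sub>R spread_displacement e1 e2 k s) \<partial>planar_cauchy)
    \<le> (\<integral>\<^sup>+t\<in>{a..b}. softened_potential m (f t) (\<gamma> t) \<partial>lborel)" .
qed

section \<open>Plateau functions as time profiles of the displacement\<close>

definition plateau :: "real \<Rightarrow> real \<Rightarrow> real \<Rightarrow> real" where
  "plateau L M t = max 0 (min 1 ((M - \<bar>t\<bar>) / (M - L)))"

lemma plateau_eq_1: "L < M \<Longrightarrow> \<bar>t\<bar> \<le> L \<Longrightarrow> plateau L M t = 1"
  by (auto simp: plateau_def)

lemma plateau_eq_0: "L < M \<Longrightarrow> M \<le> \<bar>t\<bar> \<Longrightarrow> plateau L M t = 0"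
  by (auto simp: plateau_def field_simps max_def min_def)

lemma plateau_Lipschitz:
  assumes "L < M"
  shows "\<bar>plateau L M s - plateau L M t\<bar> \<le> 1 / (M - L) * \<bar>s - t\<bar>"
proof -
  have "\<bar>plateau L M s - plateau L M t\<bar> \<le> \<bar>(M - \<bar>s\<bar>) / (M - L) - (M - \<bar>t\<bar>) / (M - L)\<bar>"
    unfolding plateau_def by (auto simp: max_def min_def)
  also have "\<dots> = \<bar>\<bar>t\<bar> - \<bar>s\<bar>\<bar> / (M - L)"
    using assms by (simp flip: diff_divide_distrib)
  also have "\<dots> \<le> \<bar>s - t\<bar> / (M - L)"
    using assms by (intro divide_right_mono) auto
  finally show ?thesis by simp
qed

lemma plateau_has_derivative:
  assumes "0 < L" "L < M" "\<bar>t\<bar> < M" "\<bar>t\<bar> \<noteq> L"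
  shows "(plateau L M has_real_derivative (if \<bar>t\<bar> < L then 0 else - sgn t / (M - L))) (at t)"
proof (cases "\<bar>t\<bar> < L")
  case True
  have "((\<lambda>_. 1) has_real_derivative 0) (at t)" by simp
  then have "(plateau L M has_real_derivative 0) (at t)"
    by (rule has_field_derivative_transform_within_open[where S = "{-L<..<L}"])
       (use True assms in \<open>auto simp: plateau_eq_1\<close>)
  then show ?thesis using True by simp
next
  case False
  then have t: "L < \<bar>t\<bar>" using assms by simp
  have "sgn t * t = \<bar>t\<bar>" by (simp add: sgn_if)
  have "((\<lambda>u. (M - sgn t * u) / (M - L)) has_real_derivative - sgn t / (M - L)) (at t)"
    using assms by (auto intro!: derivative_eq_intros)
  then have "(plateau L M has_real_derivative - sgn t / (M - L)) (at t)"
  proof (rule has_field_derivative_transform_within_open)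
    \<comment> \<open>Multiplication by \<open>sgn t\<close> treats both ramps at once: this is the
      open ramp that contains \<open>t\<close>.\<close>
    show "open {u. sgn t * u \<in> {L<..<M}}"
      by (auto intro!: open_Collect_conj open_Collect_less continuous_intros)
    show "t \<in> {u. sgn t * u \<in> {L<..<M}}" using t assms \<open>sgn t * t = \<bar>t\<bar>\<close> by simp
    fix u assume "u \<in> {u. sgn t * u \<in> {L<..<M}}"
    then have u: "sgn t * u \<in> {L<..<M}" by simp
    then have "sgn t * u = \<bar>u\<bar>" using t assms by (auto simp: sgn_if split: if_splits)
    then show "(M - sgn t * u) / (M - L) = plateau L M u"
      using u assms by (auto simp: plateau_def field_simps max_def min_def)
  qed
  then show ?thesis using False by simp
qed

lemma kinetic_energy_spread_displacement:
  fixes e1 e2 :: "'a::euclidean_space"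
  assumes e: "e1 \<in> Basis" "e2 \<in> Basis" "e1 \<noteq> e2"
  shows "kinetic_energy m (\<sigma> *\<^sub>R spread_displacement e1 e2 k s)
    = \<sigma>\<^sup>2 / 2 * (\<Sum>i\<in>UNIV. m i * (real (k i))\<^sup>2) * ((fst s)\<^sup>2 + (snd s)\<^sup>2)"
proof -
  have e': "e1 \<bullet> e1 = 1" "e2 \<bullet> e2 = 1" "e1 \<bullet> e2 = 0" "e2 \<bullet> e1 = 0"
    using e by (auto simp: inner_not_same_Basis)
  have "(norm (fst s *\<^sub>R e1 + snd s *\<^sub>R e2))\<^sup>2 = (fst s)\<^sup>2 + (snd s)\<^sup>2"
    by (simp only: power2_norm_eq_inner inner_add_left inner_add_right inner_scaleR_left inner_scaleR_right e')
       (simp add: power2_eq_square)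
  then show ?thesis
    by (simp add: kinetic_energy_scaleR kinetic_energy_def spread_displacement_def power_mult_distrib
        sum_distrib_left sum_distrib_right mult_ac)
qed

text \<open>The slope lives on two ramps of length \<open>M - L\<close>, where its square is
  \<open>1 / (M - L)\<^sup>2\<close>; long ramps therefore cost little kinetic energy.\<close>

lemma nn_integral_plateau_derivative_le:
  assumes "0 < L" "L < M" "0 \<le> K"
  shows "(\<integral>\<^sup>+t\<in>{-M..M}. ennreal (2 * (if \<bar>t\<bar> < L then 0 else - sgn t / (M - L))\<^sup>2 * K) \<partial>lborel)
    \<le> ennreal (4 * K / (M - L))"
proof -
  define c where "c = 2 * (1 / (M - L))\<^sup>2 * K"
  have "0 \<le> c" using assms by (simp add: c_def)
  have "(if \<bar>t\<bar> < L then 0 else - sgn t / (M - L))\<^sup>2 \<le> (1 / (M - L))\<^sup>2" for t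
    by (auto simp: sgn_if power_divide)
  then have le: "ennreal (2 * (if \<bar>t\<bar> < L then 0 else - sgn t / (M - L))\<^sup>2 * K) \<le> ennreal c" for t
    unfolding c_def using assms by (intro ennreal_leI mult_right_mono mult_left_mono) auto
  have "ennreal (2 * (if \<bar>t\<bar> < L then 0 else - sgn t / (M - L))\<^sup>2 * K) * indicator {-M..M} t
      \<le> ennreal c * indicator ({-M..-L} \<union> {L..M}) t" for t
  proof (cases "\<bar>t\<bar> < L")
    case False
    then have ind: "indicator {-M..M} t = (indicator ({-M..-L} \<union> {L..M}) t :: ennreal)"
      using assms by (auto split: split_indicator)
    show ?thesis unfolding ind by (rule mult_right_mono[OF le]) simp
  qed simp
  then have "(\<integral>\<^sup>+t\<in>{-M..M}. ennreal (2 * (if \<bar>t\<bar> < L then 0 else - sgn t / (M - L))\<^sup>2 * K) \<partial>lborel)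
      \<le> (\<integral>\<^sup>+t. ennreal c * indicator ({-M..-L} \<union> {L..M}) t \<partial>lborel)"
    by (rule nn_integral_mono)
  also have "\<dots> = ennreal c * emeasure lborel ({-M..-L} \<union> {L..M})"
    by (rule nn_integral_cmult_indicator) simp
  also have "\<dots> = ennreal c * ennreal (2 * (M - L))"
    using assms by (subst plus_emeasure[symmetric]) (auto simp flip: ennreal_plus)
  also have "\<dots> = ennreal (4 * K / (M - L))"
  proof -
    have "2 * (1 / w)\<^sup>2 * K * (2 * w) = 4 * K / w" if "0 < w" for w
      using that by (simp add: power2_eq_square)
    from this[of "M - L"] have "c * (2 * (M - L)) = 4 * K / (M - L)" using assms unfolding c_def by simp
    then show ?thesis using \<open>0 \<le> c\<close> by (simp only: ennreal_mult'[symmetric])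
  qed
  finally show ?thesis .
qed

text \<open>\<open>minimizer_displacement\<close> is averaged over \<open>s\<close>. Each of the two
  coordinates contributes at most \<open>R\<close> through its truncated second moment and at most
  \<open>2 / R\<close> through its tail; the two means of \<open>Q\<close> agree by symmetry, and a
  common factor 2 is divided out.\<close>

lemma minimizer_averaged_bound:
  fixes \<gamma> :: "real \<Rightarrow> 'a::euclidean_space ^ 'n::{finite,linorder}" and e1 e2 :: 'a
  assumes m: "\<And>i. m i > 0"
    and e: "e1 \<in> Basis" "e2 \<in> Basis" "e1 \<noteq> e2" and k: "inj k"
    and LM: "0 < L" "L < M" and R: "1 \<le> R"
    and ac: "abs_continuous_on {-M..M} \<gamma>" and cont: "continuous_on UNIV \<gamma>"
    and minimal: "action m (-M) M \<gamma> = action_potential m (\<gamma> (-M)) (\<gamma> M)" and finite: "action m (-M) M \<gamma> < \<infinity>"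
  defines "\<mu> \<equiv> \<Sum>i\<in>UNIV. m i * (real (k i))\<^sup>2"
  shows "potential_action m (-M) M \<gamma> \<le> ennreal (2 * \<mu> * \<sigma>\<^sup>2 * R / (M - L))
    + ennreal (4 / R) * potential_action m (-M) M \<gamma>
    + (\<integral>\<^sup>+t\<in>{-M..M}. softened_potential m (plateau L M t * \<sigma>) (\<gamma> t) \<partial>lborel)"
proof -
  define P where "P = potential_action m (-M) M \<gamma>"
  define Q where "Q s = potential_action m (-M) M (\<lambda>t. \<gamma> t + (plateau L M t * \<sigma>) *\<^sub>R spread_displacement e1 e2 k s)" for s
  define c where "c = 2 * \<mu> * \<sigma>\<^sup>2 / (M - L)"
  have "0 \<le> \<mu>" unfolding \<mu>_def using m by (intro sum_nonneg mult_nonneg_nonneg) (auto simp: less_imp_le)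
  then have "0 \<le> c" using LM by (simp add: c_def)
  have lip: "(1 / (M - L))-lipschitz_on UNIV (plateau L M)"
    using plateau_Lipschitz[OF LM(2)] LM by (auto simp: lipschitz_on_def dist_real_def)
  have cont_f: "continuous_on UNIV (\<lambda>t. plateau L M t * \<sigma>)"
    by (intro continuous_intros lipschitz_on_continuous_on[OF lip])
  note Q_bound = planar_cauchy_average_potential_action_le[OF e k cont cont_f, of m "-M" M, folded Q_def]
  note [measurable] = Q_bound(2)
  have pointwise: "2 * P \<le> ennreal (c * ((fst s)\<^sup>2 + (snd s)\<^sup>2)) + (Q s + Q (- s))" for s
  proof -
    define d where "d = \<sigma> *\<^sub>R spread_displacement e1 e2 k s"
    have minus: "spread_displacement e1 e2 k (- s) = - spread_displacement e1 e2 k s"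
      by (simp add: spread_displacement_def vec_eq_iff algebra_simps)
    have "2 * P \<le> (\<integral>\<^sup>+t\<in>{-M..M}. ennreal (2 * (if \<bar>t\<bar> < L then 0 else - sgn t / (M - L))\<^sup>2 * kinetic_energy m d) \<partial>lborel)
      + (potential_action m (-M) M (\<lambda>t. \<gamma> t + plateau L M t *\<^sub>R d) + potential_action m (-M) M (\<lambda>t. \<gamma> t - plateau L M t *\<^sub>R d))"
      unfolding P_def
    proof (rule minimizer_displacement[OF m _ ac cont minimal finite plateau_Lipschitz[OF LM(2)]])
      show "AE t in lborel. t \<in> {-M<..<M} \<longrightarrow>
          (plateau L M has_real_derivative (if \<bar>t\<bar> < L then 0 else - sgn t / (M - L))) (at t)"
        using AE_lborel_singleton[of L] AE_lborel_singleton[of "-L"]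
        by eventually_elim (intro impI plateau_has_derivative[OF LM], auto)
    qed (use LM in \<open>auto simp: plateau_eq_0\<close>)
    also have "(\<integral>\<^sup>+t\<in>{-M..M}. ennreal (2 * (if \<bar>t\<bar> < L then 0 else - sgn t / (M - L))\<^sup>2 * kinetic_energy m d) \<partial>lborel)
      \<le> ennreal (4 * kinetic_energy m d / (M - L))"
      by (rule nn_integral_plateau_derivative_le[OF LM kinetic_energy_nonneg[OF m]])
    also have "4 * kinetic_energy m d / (M - L) = c * ((fst s)\<^sup>2 + (snd s)\<^sup>2)"
      unfolding d_def kinetic_energy_spread_displacement[OF e] c_def \<mu>_def by simp
    also have "potential_action m (-M) M (\<lambda>t. \<gamma> t + plateau L M t *\<^sub>R d) = Q s"
      by (simp add: Q_def d_def)
    also have "potential_action m (-M) M (\<lambda>t. \<gamma> t - plateau L M t *\<^sub>R d) = Q (- s)"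
      by (simp add: Q_def d_def minus)
    finally show ?thesis by (simp add: add_right_mono)
  qed
  define tr :: "real \<Rightarrow> ennreal" where "tr u = ennreal (u\<^sup>2) * indicator {-R..R} u" for u
  define tl :: "real \<Rightarrow> ennreal" where "tl u = indicator {u. R < \<bar>u\<bar>} u" for u
  have [measurable]: "tr \<in> borel_measurable borel" "tl \<in> borel_measurable borel"
    unfolding tr_def tl_def by measurable
  have [measurable]: "fst \<in> borel_measurable (borel :: (real \<times> real) measure)"
    "snd \<in> borel_measurable (borel :: (real \<times> real) measure)"
    by (simp_all flip: borel_prod)
  have [measurable]: "uminus \<in> borel_measurable (borel :: (real \<times> real) measure)"
    by (intro borel_measurable_continuous_onI continuous_intros)
  \<comment> \<open>Outside the square some tail indicator is 1, and \<open>2 * P\<close> is bounded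
    by itself. The \<open>Q\<close> terms stay on the whole plane, so that the mean over the full
    distribution can be used.\<close>
  have truncated: "2 * P \<le> ennreal c * (tr (fst s) + tr (snd s)) + (2 * P) * (tl (fst s) + tl (snd s)) + (Q s + Q (- s))" for s
  proof (cases "\<bar>fst s\<bar> \<le> R \<and> \<bar>snd s\<bar> \<le> R")
    case True
    then have "ennreal (c * ((fst s)\<^sup>2 + (snd s)\<^sup>2)) = ennreal c * (tr (fst s) + tr (snd s))"
      using \<open>0 \<le> c\<close> by (auto simp: tr_def ennreal_mult abs_le_iff)
    moreover have "tl (fst s) = 0" "tl (snd s) = 0" using True by (auto simp: tl_def)
    ultimately show ?thesis using pointwise[of s] by simp
  next
    case False
    then have "1 \<le> tl (fst s) + tl (snd s)" by (auto simp: tl_def not_le split: split_indicator)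
    then have "(2 * P) * 1 \<le> (2 * P) * (tl (fst s) + tl (snd s))" by (intro mult_left_mono) auto
    then show ?thesis by (simp add: add_increasing add_increasing2)
  qed
  have tr: "(\<integral>\<^sup>+s. tr (fst s) \<partial>planar_cauchy) \<le> ennreal R" "(\<integral>\<^sup>+s. tr (snd s) \<partial>planar_cauchy) \<le> ennreal R"
    using cauchy_truncated_second_moment_le[of R] R
    by (simp_all add: nn_integral_planar_cauchy_marginals) (simp_all add: tr_def)
  have tl: "(\<integral>\<^sup>+s. tl (fst s) \<partial>planar_cauchy) \<le> ennreal (2 / R)" "(\<integral>\<^sup>+s. tl (snd s) \<partial>planar_cauchy) \<le> ennreal (2 / R)"
    using cauchy_tail_le[of R] R
    by (simp_all add: nn_integral_planar_cauchy_marginals) (simp_all add: tl_def)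
  have "2 * P = (\<integral>\<^sup>+s. 2 * P \<partial>planar_cauchy)"
    by (simp add: emeasure_planar_cauchy_UNIV)
  also have "\<dots> \<le> (\<integral>\<^sup>+s. ennreal c * (tr (fst s) + tr (snd s)) + (2 * P) * (tl (fst s) + tl (snd s)) + (Q s + Q (- s)) \<partial>planar_cauchy)"
    by (intro nn_integral_mono truncated)
  also have "\<dots> = ennreal c * ((\<integral>\<^sup>+s. tr (fst s) \<partial>planar_cauchy) + (\<integral>\<^sup>+s. tr (snd s) \<partial>planar_cauchy))
      + (2 * P) * ((\<integral>\<^sup>+s. tl (fst s) \<partial>planar_cauchy) + (\<integral>\<^sup>+s. tl (snd s) \<partial>planar_cauchy))
      + ((\<integral>\<^sup>+s. Q s \<partial>planar_cauchy) + (\<integral>\<^sup>+s. Q s \<partial>planar_cauchy))"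
    by (simp add: nn_integral_add nn_integral_cmult nn_integral_planar_cauchy_uminus)
  also have "\<dots> \<le> ennreal c * (ennreal R + ennreal R) + (2 * P) * (ennreal (2 / R) + ennreal (2 / R))
      + ((\<integral>\<^sup>+s. Q s \<partial>planar_cauchy) + (\<integral>\<^sup>+s. Q s \<partial>planar_cauchy))"
    by (intro add_mono mult_left_mono tr tl order_refl) auto
  also have "\<dots> = 2 * (ennreal (c * R) + ennreal (4 / R) * P + (\<integral>\<^sup>+s. Q s \<partial>planar_cauchy))"
  proof -
    have "ennreal (2 / R) + ennreal (2 / R) = ennreal (4 / R)" using R by (simp flip: ennreal_plus)
    then show ?thesis using R \<open>0 \<le> c\<close> by (simp add: ennreal_mult mult_2 mult_2_right distrib_left distrib_right ac_simps)
  qed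
  finally have "P \<le> ennreal (c * R) + ennreal (4 / R) * P + (\<integral>\<^sup>+s. Q s \<partial>planar_cauchy)"
    by (subst (asm) ennreal_mult_le_mult_iff) auto
  also have "\<dots> \<le> ennreal (c * R) + ennreal (4 / R) * P
      + (\<integral>\<^sup>+t\<in>{-M..M}. softened_potential m (plateau L M t * \<sigma>) (\<gamma> t) \<partial>lborel)"
    by (intro add_left_mono Q_bound(1))
  finally show ?thesis by (simp add: P_def c_def)
qed

section \<open>Finiteness of the action potential\<close>

text \<open>Finite action near the ends requires an integrable \<open>1 / bump\<close> and an
  integrable squared derivative. The exponent 2/3, that of parabolic collision motion, gives both
  the same singularity of order -2/3.\<close>

definition bump :: "real \<Rightarrow> real" where
  "bump t = (max 0 (t * (1 - t))) powr (2/3)"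

text \<open>Equal to \<open>1 / bump\<close> inside the unit interval, written as the integrand of a
  Beta integral.\<close>

definition bump_weight :: "real \<Rightarrow> real" where
  "bump_weight t = t powr (1/3 - 1) * (1 - t) powr (1/3 - 1)"

lemma bump_weight_has_integral: "(bump_weight has_integral Beta (1/3) (1/3)) {0..1}"
  unfolding bump_weight_def using has_integral_Beta_real[of "1/3" "1/3"] by simp

lemma bump_weight_nonneg: "0 \<le> bump_weight t"
  by (simp add: bump_weight_def)

lemma bump_ends [simp]: "bump 0 = 0" "bump 1 = 0"
  by (simp_all add: bump_def)

lemma continuous_bump: "continuous_on UNIV bump"
  unfolding bump_def by (intro continuous_on_powr' continuous_intros) auto

lemma bump_pos: "t \<in> {0<..<1} \<Longrightarrow> 0 < bump t"
  by (simp add: bump_def)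

lemma inverse_bump: "t \<in> {0<..<1} \<Longrightarrow> 1 / bump t = bump_weight t"
  using powr_minus_divide[of "t * (1 - t)" "2/3"] by (simp add: bump_def bump_weight_def powr_mult)

definition bump_deriv :: "real \<Rightarrow> real" where
  "bump_deriv t = 2/3 * (t powr (-1/3) * (1 - t) powr (-1/3)) * (1 - 2 * t)"

lemma bump_has_derivative:
  assumes "t \<in> {0<..<1}"
  shows "(bump has_real_derivative bump_deriv t) (at t)"
proof -
  have pos: "0 < t * (1 - t)" using assms by simp
  have "((\<lambda>t. (t * (1 - t)) powr (2/3)) has_real_derivative 2/3 * (t * (1 - t)) powr (2/3 - 1) * (1 - 2 * t)) (at t)"
    using pos by (auto intro!: derivative_eq_intros simp: algebra_simps)
  also have "2/3 * (t * (1 - t)) powr (2/3 - 1) * (1 - 2 * t) = bump_deriv t"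
    using assms by (simp add: bump_deriv_def powr_mult)
  finally show ?thesis
    by (rule has_field_derivative_transform_within_open[where S = "{0<..<1}"])
       (use assms in \<open>auto simp: bump_def max_def\<close>)
qed

text \<open>The powers on the two sides agree, and the remaining factor
  \<open>2/3 * (1 - 2 * t)\<close> is at most 1 in absolute value. At the endpoints both sides are
  0, since \<open>0 powr a = 0\<close>.\<close>

lemma bump_deriv_square_le:
  assumes "t \<in> {0..1}"
  shows "(bump_deriv t)\<^sup>2 \<le> bump_weight t"
proof -
  have sq: "(x powr (-1/3))\<^sup>2 = x powr (1/3 - 1)" if "0 \<le> x" for x :: real
    using that by (simp add: power2_eq_square flip: powr_add)
  have "(bump_deriv t)\<^sup>2 = (2/3 * (1 - 2 * t))\<^sup>2 * bump_weight t"
  proof -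
    have "(2/3 * (x * y) * c)\<^sup>2 = (2/3 * c)\<^sup>2 * (x\<^sup>2 * y\<^sup>2)" for x y c :: real
      by (simp add: power2_eq_square)
    then show ?thesis
      using assms sq[of t] sq[of "1 - t"] unfolding bump_deriv_def bump_weight_def by simp
  qed
  also have "\<dots> \<le> 1 * bump_weight t"
  proof (intro mult_right_mono bump_weight_nonneg)
    have "\<bar>2/3 * (1 - 2 * t)\<bar> \<le> 1" using assms by (auto simp: abs_le_iff)
    then show "(2/3 * (1 - 2 * t))\<^sup>2 \<le> 1" by (simp add: abs_square_le_1)
  qed
  finally show ?thesis by simp
qed

text \<open>The derivative is unbounded at the ends, so a Lipschitz bound fails; its square is
  dominated by the integrable \<open>bump_weight\<close> instead.\<close>

lemma abs_continuous_on_bump: "abs_continuous_on {0..1} bump"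
proof (rule abs_continuous_on_IccI[OF has_integral_integrable[OF bump_weight_has_integral] bump_weight_nonneg])
  fix s t K :: real assume st: "0 \<le> s" "s \<le> t" "t \<le> 1" and K: "0 < K"
  have deriv: "(bump_deriv has_integral (bump t - bump s)) {s..t}"
    using st bump_has_derivative
    by (intro fundamental_theorem_of_calculus_interior continuous_on_subset[OF continuous_bump])
       (auto simp: has_real_derivative_iff_has_vector_derivative)
  have "bump_weight integrable_on {s..t}"
    using st by (intro integrable_on_subinterval[OF has_integral_integrable[OF bump_weight_has_integral]]) auto
  then have "((\<lambda>u. K + bump_weight u / K) has_integral (K * (t - s) + integral {s..t} bump_weight / K)) {s..t}"
    using st by (intro has_integral_add has_integral_divide integrable_integral)
      (auto intro!: has_integral_const_real[THEN has_integral_eq_rhs] simp: mult.commute)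
  moreover have bound: "\<bar>bump_deriv u\<bar> \<le> K + bump_weight u / K" if "u \<in> {s..t}" for u
  proof -
    have "K * \<bar>bump_deriv u\<bar> \<le> K\<^sup>2 + \<bar>bump_deriv u\<bar>\<^sup>2"
      using sum_squares_bound[of K "\<bar>bump_deriv u\<bar>"] K mult_nonneg_nonneg[of K "\<bar>bump_deriv u\<bar>"] by linarith
    also have "\<dots> \<le> K\<^sup>2 + bump_weight u"
      using bump_deriv_square_le[of u] that st by simp
    finally show ?thesis using K by (simp add: field_simps power2_eq_square)
  qed
  ultimately have "bump t - bump s \<le> K * (t - s) + integral {s..t} bump_weight / K"
    "- (bump t - bump s) \<le> K * (t - s) + integral {s..t} bump_weight / K"
    using has_integral_le[OF deriv] has_integral_le[OF has_integral_neg[OF deriv]] by (auto simp: abs_le_iff)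
  then show "norm (bump t - bump s) \<le> K * (t - s) + integral {s..t} bump_weight / K"
    by (simp add: abs_le_iff)
qed

text \<open>The segment from \<open>x\<close> to \<open>y\<close> may meet collisions, even at its
  ends. Displaced by \<open>bump t\<close> times a random vector it has mean potential action at
  most \<open>B\<close> times the integral of \<open>1 / bump\<close>, so some displacement gives a
  finite value; its kinetic energy is finite because \<open>bump_deriv\<close> is square
  integrable.\<close>

lemma action_potential_finite:
  fixes x y :: "'a::euclidean_space ^ 'n::{finite,linorder}"
  assumes m: "\<And>i. m i > 0" and dim: "DIM('a) \<ge> 2"
  shows "action_potential m x y < \<infinity>"
proof -
  obtain e1 e2 :: 'a where e: "e1 \<in> Basis" "e2 \<in> Basis" "e1 \<noteq> e2"
    using dim card_le_Suc0_iff_eq[of "Basis :: 'a set"] by fastforce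
  obtain k :: "'n \<Rightarrow> nat" where k: "inj k"
    using finite_imp_inj_to_nat_seg[of "UNIV :: 'n set"] by auto
  define B where "B = (\<Sum>(i, j) | i < (j :: 'n). m i * m j)"
  have "0 \<le> B" unfolding B_def using m by (auto intro!: sum_nonneg mult_nonneg_nonneg simp: less_imp_le)
  define \<eta> where "\<eta> t = x + t *\<^sub>R (y - x)" for t
  have cont: "continuous_on UNIV \<eta>" unfolding \<eta>_def by (intro continuous_intros)
  define c where "c s t = \<eta> t + bump t *\<^sub>R spread_displacement e1 e2 k s" for s t
  have weight: "(\<integral>\<^sup>+t. ennreal (bump_weight t) * indicator {0..1} t \<partial>lborel) = ennreal (Beta (1/3) (1/3))"
    by (rule nn_integral_has_integral_lebesgue'[OF _ bump_weight_has_integral]) (rule bump_weight_nonneg)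
  have [measurable]: "bump_weight \<in> borel_measurable borel"
    unfolding bump_weight_def by measurable
  have "(\<integral>\<^sup>+s. potential_action m 0 1 (c s) \<partial>planar_cauchy)
      \<le> (\<integral>\<^sup>+t\<in>{0..1}. softened_potential m (bump t) (\<eta> t) \<partial>lborel)"
    unfolding c_def by (rule planar_cauchy_average_potential_action_le[OF e k cont continuous_bump])
  also have "\<dots> \<le> (\<integral>\<^sup>+t. ennreal B * (ennreal (bump_weight t) * indicator {0..1} t) \<partial>lborel)"
  proof (rule nn_integral_mono_AE)
    have le: "softened_potential m (bump t) (\<eta> t) * indicator {0..1} t \<le> ennreal B * (ennreal (bump_weight t) * indicator {0..1} t)"
      if "t \<noteq> 0" "t \<noteq> 1" for t
    proof (cases "t \<in> {0<..<1}")
      case True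
      have "B / bump t = B * bump_weight t" using inverse_bump[OF True] by (simp add: divide_inverse)
      then show ?thesis
        using softened_potential_le_const[of m "bump t" "\<eta> t", OF m bump_pos[OF True], folded B_def] True \<open>0 \<le> B\<close>
        by (simp add: ennreal_mult')
    qed (use that in \<open>auto split: split_indicator\<close>)
    show "AE t in lborel. softened_potential m (bump t) (\<eta> t) * indicator {0..1} t
        \<le> ennreal B * (ennreal (bump_weight t) * indicator {0..1} t)"
      using AE_lborel_singleton[of 0] AE_lborel_singleton[of 1] by eventually_elim (rule le)
  qed
  also have "\<dots> = ennreal B * ennreal (Beta (1/3) (1/3))"
    by (subst nn_integral_cmult) (simp_all add: weight)
  also have "\<dots> < \<infinity>" by (simp add: ennreal_mult_less_top)
  finally have fin: "(\<integral>\<^sup>+s. potential_action m 0 1 (c s) \<partial>planar_cauchy) < \<infinity>" .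
  have "\<exists>s. potential_action m 0 1 (c s) < \<infinity>"
  proof (rule ccontr)
    assume "\<not> ?thesis"
    then have "potential_action m 0 1 (c s) = \<infinity>" for s
      by (metis infinity_ennreal_def top.not_eq_extremum)
    then show False using fin by (simp add: emeasure_planar_cauchy_UNIV)
  qed
  then obtain s where s: "potential_action m 0 1 (c s) < \<infinity>" ..
  define w where "w = spread_displacement e1 e2 k s"
  have c: "c s = (\<lambda>t. bump t *\<^sub>R w + \<eta> t)" by (simp add: c_def w_def fun_eq_iff)
  have "abs_continuous_on {0..1} (c s)"
    unfolding c
    by (rule abs_continuous_on_add_Lipschitz[OF abs_continuous_on_scaleR[OF abs_continuous_on_bump], where K = "norm (y - x)"])
       (simp add: \<eta>_def flip: scaleR_diff_left)
  moreover have "c s 0 = x" "c s 1 = y" by (simp_all add: c \<eta>_def)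
  ultimately have "action_potential m x y \<le> action m 0 1 (c s)"
    unfolding action_potential_def by (intro Inf_lower) force
  also have "\<dots> \<le> (\<integral>\<^sup>+t. ennreal (kinetic_energy m (vector_derivative (c s) (at t within {0..1}))) * indicator {0..1} t \<partial>lborel)
      + potential_action m 0 1 (c s)"
  proof -
    have cont_c: "continuous_on UNIV (c s)" unfolding c by (intro continuous_intros continuous_bump cont)
    have [measurable]: "(\<lambda>t. newton_potential m (c s t) * indicator {0..1} t) \<in> borel_measurable borel"
      using borel_measurable_newton_potential[OF cont_c] by measurable
    have "action m 0 1 (c s) = (\<integral>\<^sup>+t. ennreal (kinetic_energy m (vector_derivative (c s) (at t within {0..1}))) * indicator {0..1} t
        + newton_potential m (c s t) * indicator {0..1} t \<partial>lborel)"
      unfolding action_def lagrangian_eq nn_integral_completion by (simp add: distrib_right)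
    then show ?thesis
      unfolding potential_action_def by (simp add: nn_integral_add_measurable_le)
  qed
  also have "\<dots> < \<infinity>"
  proof -
    define C where "C = 2 * kinetic_energy m (y - x)"
    define D where "D = 2 * kinetic_energy m w"
    have nonneg: "0 \<le> C" "0 \<le> D" by (simp_all add: C_def D_def kinetic_energy_nonneg[OF m])
    have le: "ennreal (kinetic_energy m (vector_derivative (c s) (at t within {0..1}))) * indicator {0..1} t
        \<le> ennreal C * indicator {0..1} t + ennreal D * (ennreal (bump_weight t) * indicator {0..1} t)"
      if "t \<noteq> 0" "t \<noteq> 1" for t
    proof (cases "t \<in> {0<..<1}")
      case True
      have "(c s has_vector_derivative (y - x) + bump_deriv t *\<^sub>R w) (at t)"
        unfolding c \<eta>_def using bump_has_derivative[OF True]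
        by (auto intro!: derivative_eq_intros simp: has_real_derivative_iff_has_vector_derivative)
      then have "vector_derivative (c s) (at t within {0..1}) = (y - x) + bump_deriv t *\<^sub>R w"
        using True by (simp add: at_within_Icc_at vector_derivative_at)
      \<comment> \<open>Dropping the energy of the difference from the parallelogram identity; this
        is the source of the factors 2 in \<open>C\<close> and \<open>D\<close>.\<close>
      also have "kinetic_energy m \<dots> \<le> C + (bump_deriv t)\<^sup>2 * D"
        using kinetic_energy_parallelogram[of m "y - x" "bump_deriv t *\<^sub>R w"]
          kinetic_energy_nonneg[of m "(y - x) - bump_deriv t *\<^sub>R w", OF m]
        by (simp add: C_def D_def kinetic_energy_scaleR)
      also have "\<dots> \<le> C + bump_weight t * D"
        using bump_deriv_square_le[of t] True nonneg by (simp add: mult_right_mono)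
      finally have "ennreal (kinetic_energy m (vector_derivative (c s) (at t within {0..1}))) \<le> ennreal (C + D * bump_weight t)"
        by (simp add: ennreal_leI mult.commute)
      then show ?thesis using True nonneg by (simp add: ennreal_mult' ennreal_plus bump_weight_nonneg)
    qed (use that in \<open>auto split: split_indicator\<close>)
    have "(\<integral>\<^sup>+t. ennreal (kinetic_energy m (vector_derivative (c s) (at t within {0..1}))) * indicator {0..1} t \<partial>lborel)
        \<le> (\<integral>\<^sup>+t. ennreal C * indicator {0..1} t + ennreal D * (ennreal (bump_weight t) * indicator {0..1} t) \<partial>lborel)"
    proof (rule nn_integral_mono_AE)
      show "AE t in lborel. ennreal (kinetic_energy m (vector_derivative (c s) (at t within {0..1}))) * indicator {0..1} t
        \<le> ennreal C * indicator {0..1} t + ennreal D * (ennreal (bump_weight t) * indicator {0..1} t)"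
        using AE_lborel_singleton[of 0] AE_lborel_singleton[of 1] by eventually_elim (rule le)
    qed
    also have "\<dots> = ennreal C + ennreal D * ennreal (Beta (1/3) (1/3))"
      by (simp add: nn_integral_add nn_integral_cmult weight nn_integral_cmult_indicator)
    also have "\<dots> < \<infinity>" by (simp add: ennreal_mult_less_top)
    finally show ?thesis using s by simp
  qed
  finally show ?thesis .
qed

section \<open>Absence of entire free time minimizers\<close>

text \<open>If the claim fails at \<open>L\<close>, then \<open>g\<close> doubles over a step of
  width \<open>k * l\<^sup>2 / g l ^ 3\<close> from each point \<open>l\<close> reached. These
  widths shrink geometrically with sum at most \<open>L\<close>, so \<open>g (2 * L)\<close> would
  exceed every \<open>2 ^ n * g L\<close>.\<close>

lemma cube_root_growth:
  fixes g :: "real \<Rightarrow> real"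
  assumes mono: "\<And>L M. 0 < L \<Longrightarrow> L \<le> M \<Longrightarrow> g L \<le> g M"
    and a: "a > 0" and b: "b > 0"
    and bound: "\<And>L M \<sigma> R. 0 < L \<Longrightarrow> L < M \<Longrightarrow> \<sigma> > 0 \<Longrightarrow> R \<ge> 1 \<Longrightarrow>
      g L \<le> a * L / \<sigma> + b * \<sigma>\<^sup>2 * R / (M - L) + 4 / R * g M"
    and L: "0 < L" and nonneg: "0 \<le> g L"
  shows "g L ^ 3 \<le> 8192 * a\<^sup>2 * b * L"
proof (rule ccontr)
  assume "\<not> ?thesis"
  then have large: "8192 * a\<^sup>2 * b * L < g L ^ 3" by simp
  have "0 \<le> 8192 * a\<^sup>2 * b * L" using b L by simp
  with large have gL: "0 < g L" using nonneg by (cases "g L = 0") auto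
  \<comment> \<open>The choices below give \<open>b * \<sigma>\<^sup>2 * 16 / w = 256 * a\<^sup>2 *
    b * g l / k\<close>, which is to be \<open>g l / 4\<close>. The constant 8192 of the claim is
    \<open>8 * 1024\<close>, making the first step at most \<open>L / 2\<close>.\<close>
  define k where "k = 1024 * a\<^sup>2 * b"
  have "k > 0" using a b by (simp add: k_def)
  have step: "2 * g l \<le> g (l + k * l\<^sup>2 / g l ^ 3)" if "0 < l" "0 < g l" for l
  proof -
    \<comment> \<open>With this \<open>\<sigma>\<close> and \<open>R = 16\<close> the first two
      terms of \<open>bound\<close> are a quarter of \<open>g l\<close> each and the last is a
      quarter of \<open>g (l + w)\<close>.\<close>
    define \<sigma> where "\<sigma> = 4 * a * l / g l"
    define w where "w = k * l\<^sup>2 / g l ^ 3"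
    have "\<sigma> > 0" "w > 0" using that a \<open>k > 0\<close> by (simp_all add: \<sigma>_def w_def)
    have "a * l / \<sigma> = g l / 4" using that a by (simp add: \<sigma>_def)
    moreover have "b * \<sigma>\<^sup>2 * 16 / w = g l / 4"
      using that a b by (simp add: \<sigma>_def w_def k_def power2_eq_square power3_eq_cube)
    ultimately have "g l \<le> g l / 4 + g l / 4 + 4 / 16 * g (l + w)"
      using bound[of l "l + w" \<sigma> 16] that \<open>\<sigma> > 0\<close> \<open>w > 0\<close> by simp
    then show ?thesis by (simp add: w_def)
  qed
  \<comment> \<open>Step \<open>n\<close> may use up length \<open>L / (2 * 2 ^ n)\<close>; its
    actual width is of order \<open>8 ^ (- n)\<close>, as \<open>g l ^ 3\<close> grows by a factor 8
    per doubling while \<open>l\<close> stays below \<open>2 * L\<close>.\<close>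
  have "\<exists>l. L \<le> l \<and> l \<le> L * (2 - 1 / 2 ^ n) \<and> 2 ^ n * g L \<le> g l" for n :: nat
  proof (induction n)
    case 0
    then show ?case by (intro exI[of _ L]) simp
  next
    case (Suc n)
    then obtain l where l: "L \<le> l" "l \<le> L * (2 - 1 / 2 ^ n)" "2 ^ n * g L \<le> g l" by blast
    have gl: "0 < g l" using l(3) gL by (meson less_le_trans mult_pos_pos zero_less_numeral zero_less_power)
    define w where "w = k * l\<^sup>2 / g l ^ 3"
    have "0 \<le> w" using gl \<open>k > 0\<close> by (simp add: w_def)
    have "l \<le> 2 * L"
    proof -
      have "L * (2 - 1 / 2 ^ n) \<le> L * 2" using L by (intro mult_left_mono) auto
      then show ?thesis using l(2) by linarith
    qed
    have "w \<le> k * (2 * L)\<^sup>2 / (2 ^ n * g L) ^ 3"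
      unfolding w_def using l \<open>l \<le> 2 * L\<close> L gL \<open>k > 0\<close>
      by (intro frac_le mult_left_mono power_mono) auto
    also have "\<dots> = (8 * k * L / g L ^ 3) * (L / 2) / 8 ^ n"
    proof -
      have "((2::real) ^ n) ^ 3 = 8 ^ n" by (simp add: power_mult[symmetric] mult.commute[of n]) (simp add: power_mult)
      then show ?thesis by (simp add: power_mult_distrib power2_eq_square mult_ac)
    qed
    also have "\<dots> \<le> 1 * (L / 2) / 8 ^ n"
      using large gL L by (intro divide_right_mono mult_right_mono) (simp_all add: k_def)
    also have "\<dots> \<le> (L / 2) / 2 ^ n"
      using L by (simp add: divide_left_mono power_mono)
    finally have "w \<le> L / (2 * 2 ^ n)" by simp
    then have "l + w \<le> L * (2 - 1 / 2 ^ Suc n)"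
      using l(2) by (simp add: algebra_simps)
    moreover have "2 ^ Suc n * g L \<le> g (l + w)"
      using step[of l] l gl L by (simp add: w_def)
    ultimately show ?case using \<open>0 \<le> w\<close> l(1) by (intro exI[of _ "l + w"]) auto
  qed
  then have bounded: "2 ^ n * g L \<le> g (2 * L)" for n :: nat
  proof -
    obtain l where l: "L \<le> l" "l \<le> L * (2 - 1 / 2 ^ n)" "2 ^ n * g L \<le> g l"
      using \<open>\<And>n. \<exists>l. L \<le> l \<and> l \<le> L * (2 - 1 / 2 ^ n) \<and> 2 ^ n * g L \<le> g l\<close> by blast
    have "L * (2 - 1 / 2 ^ n) \<le> L * 2" using L by (intro mult_left_mono) auto
    then have "g l \<le> g (2 * L)" using l L by (intro mono) linarith+
    then show ?thesis using l(3) by simp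
  qed
  obtain n where "g (2 * L) / g L < 2 ^ n" using real_arch_pow[of 2] by auto
  then show False using bounded[of n] gL by (simp add: field_simps)
qed

text \<open>With \<open>M = 1 + R\<^sup>2\<close> the first term of \<open>bound\<close> is
  \<open>b / R\<close>, and cube root growth makes the second of order \<open>R powr (-1/3)\<close>;
  for large \<open>R\<close> their sum falls below \<open>c\<close>.\<close>

lemma averaged_bounds_contradiction:
  fixes g :: "real \<Rightarrow> real"
  assumes "c > 0" and b: "b \<ge> 0" and C: "C \<ge> 0"
    and nonneg: "\<And>M. 0 \<le> g M" and growth: "\<And>M. M > 0 \<Longrightarrow> g M ^ 3 \<le> C * M"
    and bound: "\<And>M R. M > 1 \<Longrightarrow> R \<ge> 1 \<Longrightarrow> c \<le> b * R / (M - 1) + 4 / R * g M"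
  shows False
proof -
  \<comment> \<open>The second summand ensures \<open>b / R < c / 4\<close>, which forces
    \<open>g M / R > c / 8\<close>; the third contradicts the resulting
    \<open>(c / 8) ^ 3 < 2 * C / R\<close>.\<close>
  define R where "R = 1 + 4 * b / c + 2 * C / (c / 8) ^ 3"
  have R: "1 \<le> R" "4 * b / c < R" "2 * C / (c / 8) ^ 3 < R"
    using assms(1) b C by (simp_all add: R_def add_nonneg_pos add_pos_nonneg)
  have "b * R / (1 + R\<^sup>2 - 1) = b / R" using R(1) by (simp add: power2_eq_square)
  moreover have "b / R < c / 4" using R \<open>c > 0\<close> by (simp add: field_simps)
  moreover have "c \<le> b * R / (1 + R\<^sup>2 - 1) + 4 / R * g (1 + R\<^sup>2)"
    using R(1) by (intro bound) auto
  moreover have "4 / R * g (1 + R\<^sup>2) = 4 * (g (1 + R\<^sup>2) / R)" by simp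
  ultimately have "c / 8 < g (1 + R\<^sup>2) / R" using \<open>c > 0\<close> by linarith
  then have "(c / 8) ^ 3 < (g (1 + R\<^sup>2) / R) ^ 3"
    using \<open>c > 0\<close> by (intro power_strict_mono) auto
  also have "\<dots> \<le> C * (1 + R\<^sup>2) / R ^ 3"
    using growth[of "1 + R\<^sup>2"] R(1) by (simp add: power_divide divide_right_mono add_pos_nonneg)
  also have "\<dots> \<le> C * (2 * R\<^sup>2) / R ^ 3"
    using R(1) C by (intro divide_right_mono mult_left_mono) auto
  also have "\<dots> = 2 * C / R"
    using R(1) by (simp add: power2_eq_square power3_eq_cube)
  finally have "(c / 8) ^ 3 < 2 * C / R" .
  then show False using R \<open>c > 0\<close> by (simp add: field_simps)
qed

theorem theorem2:
  fixes m :: "'n::{finite,linorder} \<Rightarrow> real"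
  assumes "DIM('a::euclidean_space) \<ge> 2"
    and "CARD('n) \<ge> 2"
    and "\<And>i. m i > 0"
  shows "\<not> (\<exists>x :: real \<Rightarrow> 'a ^ 'n::_. free_time_minimizer_on m UNIV x)"
proof
  assume "\<exists>x :: real \<Rightarrow> 'a ^ 'n::_. free_time_minimizer_on m UNIV x"
  then obtain \<gamma> :: "real \<Rightarrow> 'a ^ 'n::_" where \<gamma>: "free_time_minimizer_on m UNIV \<gamma>" ..
  note m = assms(3)
  have ac: "abs_continuous_on {a..b} \<gamma>" and minimal: "action m a b \<gamma> = action_potential m (\<gamma> a) (\<gamma> b)"
    if "a < b" for a b
    using \<gamma> that by (auto simp: free_time_minimizer_on_def)
  have action_finite: "action m a b \<gamma> < \<infinity>" if "a < b" for a b
    unfolding minimal[OF that] by (rule action_potential_finite[OF m assms(1)])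
  have cont: "continuous_on UNIV \<gamma>"
  proof (intro continuous_at_imp_continuous_on ballI)
    fix t :: real
    have "continuous_on {t - 1..t + 1} \<gamma>"
      by (intro abs_continuous_on_imp_continuous_on_Icc ac) simp
    then have "continuous_on {t - 1<..<t + 1} \<gamma>"
      by (rule continuous_on_subset) auto
    then show "isCont \<gamma> t"
      by (simp add: continuous_on_eq_continuous_at)
  qed
  note [measurable] = borel_measurable_newton_potential[OF cont]
  obtain e1 e2 :: 'a where e: "e1 \<in> Basis" "e2 \<in> Basis" "e1 \<noteq> e2"
    using assms(1) card_le_Suc0_iff_eq[of "Basis :: 'a set"] by fastforce
  obtain k :: "'n \<Rightarrow> nat" where k: "inj k"
    using finite_imp_inj_to_nat_seg[of "UNIV :: 'n set"] by auto
  have "\<exists>i j :: 'n. i \<noteq> j"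
    using assms(2) card_le_Suc0_iff_eq[of "UNIV :: 'n set"] by fastforce
  then obtain i j :: 'n where "i < j"
    by (metis linorder_neqE)

  define \<mu> where "\<mu> = (\<Sum>i\<in>UNIV. m i * (real (k i))\<^sup>2)"
  define B where "B = (\<Sum>(i, j) | i < (j :: 'n). m i * m j)"
  have "0 \<le> \<mu>" unfolding \<mu>_def using m by (intro sum_nonneg mult_nonneg_nonneg) (auto simp: less_imp_le)
  have "0 \<le> B" unfolding B_def using m by (auto intro!: sum_nonneg mult_nonneg_nonneg simp: less_imp_le)
  define P where "P L = potential_action m (-L) L \<gamma>" for L
  define g where "g L = enn2real (P L)" for L
  have P_finite: "P L < \<infinity>" if "0 < L" for L
  proof -
    have "P L \<le> action m (-L) L \<gamma>"
      unfolding P_def potential_action_def action_def lagrangian_eq nn_integral_completion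
      by (intro nn_integral_mono mult_right_mono) auto
    then show ?thesis using action_finite[of "-L" L] that by simp
  qed
  have P_eq: "P L = ennreal (g L)" if "0 < L" for L
    using P_finite[OF that] by (simp add: g_def)
  have g_nonneg: "0 \<le> g L" for L by (simp add: g_def)
  define S where "S L M \<sigma> = (\<integral>\<^sup>+t\<in>{-M..M}. softened_potential m (plateau L M t * \<sigma>) (\<gamma> t) \<partial>lborel)" for L M \<sigma>
  have averaged: "P M \<le> ennreal (2 * \<mu> * \<sigma>\<^sup>2 * R / (M - L)) + ennreal (4 / R) * P M + S L M \<sigma>"
    if "0 < L" "L < M" "1 \<le> R" for L M R \<sigma>
    unfolding P_def S_def \<mu>_def
    using that by (intro minimizer_averaged_bound[OF m e k that ac cont minimal action_finite]) auto

  have growth_bound: "g L \<le> 2 * B * L / \<sigma> + 2 * \<mu> * \<sigma>\<^sup>2 * R / (M - L) + 4 / R * g M"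
    if LM: "0 < L" "L < M" and "0 < \<sigma>" "1 \<le> R" for L M \<sigma> R
  proof -
    \<comment> \<open>Off the plateau the softened potential is bounded by the Newtonian one, so
      \<open>A\<close> occurs on both sides and cancels. On the plateau it is at most
      \<open>B / \<sigma>\<close>.\<close>
    define A where "A = (\<integral>\<^sup>+t. newton_potential m (\<gamma> t) * indicator ({-M..M} - {-L..L}) t \<partial>lborel)"
    have split: "indicator {-M..M} t = (indicator {-L..L} t + indicator ({-M..M} - {-L..L}) t :: ennreal)" for t
      using LM by (auto split: split_indicator)
    have "P M = P L + A"
      unfolding P_def potential_action_def A_def split distrib_left by (rule nn_integral_add) measurable
    have "A < \<infinity>" using P_finite[of M] LM \<open>P M = P L + A\<close> by simp
    have "S L M \<sigma> \<le> (\<integral>\<^sup>+t. ennreal (B / \<sigma>) * indicator {-L..L} t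
        + newton_potential m (\<gamma> t) * indicator ({-M..M} - {-L..L}) t \<partial>lborel)"
      unfolding S_def
    proof (rule nn_integral_mono)
      fix t :: real
      show "softened_potential m (plateau L M t * \<sigma>) (\<gamma> t) * indicator {-M..M} t
        \<le> ennreal (B / \<sigma>) * indicator {-L..L} t + newton_potential m (\<gamma> t) * indicator ({-M..M} - {-L..L}) t"
      proof (cases "t \<in> {-L..L}")
        case True
        then have "plateau L M t = 1" using LM by (intro plateau_eq_1) auto
        then show ?thesis
          using softened_potential_le_const[of m \<sigma> "\<gamma> t", OF m \<open>0 < \<sigma>\<close>, folded B_def] True LM by simp
      next
        case False
        then show ?thesis
          using softened_potential_le_newton_potential by (auto split: split_indicator)
      qed
    qed
    also have "\<dots> = ennreal (B / \<sigma>) * ennreal (2 * L) + A"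
      unfolding A_def using LM by (simp add: nn_integral_add nn_integral_cmult_indicator)
    also have "ennreal (B / \<sigma>) * ennreal (2 * L) = ennreal (2 * B * L / \<sigma>)"
      using \<open>0 \<le> B\<close> \<open>0 < \<sigma>\<close> by (simp add: ennreal_mult'[symmetric] mult_ac)
    finally have "P L + A \<le> ennreal (2 * \<mu> * \<sigma>\<^sup>2 * R / (M - L)) + ennreal (4 / R) * P M + (ennreal (2 * B * L / \<sigma>) + A)"
      using averaged[OF LM \<open>1 \<le> R\<close>, of \<sigma>] unfolding \<open>P M = P L + A\<close>
      by (rule order_trans[OF _ add_left_mono, rotated])
    then have "P L \<le> ennreal (2 * \<mu> * \<sigma>\<^sup>2 * R / (M - L)) + ennreal (4 / R) * P M + ennreal (2 * B * L / \<sigma>)"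
      using \<open>A < \<infinity>\<close> by (auto simp: add.assoc[symmetric] add.commute[of _ A] ennreal_add_left_cancel_le)
    also have "\<dots> = ennreal (2 * \<mu> * \<sigma>\<^sup>2 * R / (M - L) + 4 / R * g M + 2 * B * L / \<sigma>)"
      using LM \<open>0 < \<sigma>\<close> \<open>1 \<le> R\<close> \<open>0 \<le> \<mu>\<close> \<open>0 \<le> B\<close> g_nonneg[of M]
      by (simp add: P_eq ennreal_plus ennreal_mult'[symmetric])
    finally have "g L \<le> 2 * \<mu> * \<sigma>\<^sup>2 * R / (M - L) + 4 / R * g M + 2 * B * L / \<sigma>"
      unfolding P_eq[OF LM(1)]
      using LM \<open>0 < \<sigma>\<close> \<open>1 \<le> R\<close> \<open>0 \<le> \<mu>\<close> \<open>0 \<le> B\<close> g_nonneg[of M]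
      by (subst (asm) ennreal_le_iff) auto
    then show ?thesis by linarith
  qed

  have g_mono: "g L \<le> g M" if "0 < L" "L \<le> M" for L M
  proof -
    have "P L \<le> P M"
      unfolding P_def potential_action_def using that
      by (intro nn_integral_mono mult_left_mono) (auto split: split_indicator)
    then show ?thesis using that g_nonneg by (simp add: P_eq)
  qed
  have growth: "g L ^ 3 \<le> 8192 * (2 * B + 1)\<^sup>2 * (2 * \<mu> + 1) * L" if "0 < L" for L
  \<comment> \<open>The summands 1 in the constants provide the strict positivity that
    \<open>cube_root_growth\<close> asks for.\<close>
  proof (rule cube_root_growth[OF g_mono _ _ _ that g_nonneg])
    fix L M \<sigma> R :: real
    assume *: "0 < L" "L < M" "\<sigma> > 0" "R \<ge> 1"
    have "2 * B * L / \<sigma> \<le> (2 * B + 1) * L / \<sigma>"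
      using * by (intro divide_right_mono mult_right_mono) auto
    moreover have "2 * \<mu> * \<sigma>\<^sup>2 * R / (M - L) \<le> (2 * \<mu> + 1) * \<sigma>\<^sup>2 * R / (M - L)"
      using * by (intro divide_right_mono mult_right_mono) auto
    ultimately show "g L \<le> (2 * B + 1) * L / \<sigma> + (2 * \<mu> + 1) * \<sigma>\<^sup>2 * R / (M - L) + 4 / R * g M"
      using growth_bound[OF *] by linarith
  qed (use \<open>0 \<le> B\<close> \<open>0 \<le> \<mu>\<close> in auto)

  \<comment> \<open>A bound \<open>D\<close> for one mutual distance on \<open>{-1..1}\<close> makes
    the gain \<open>\<delta>\<close> from softening uniform in time.\<close>
  have "compact ((\<lambda>t. \<gamma> t $ i - \<gamma> t $ j) ` {-1..1})"
    by (intro compact_continuous_image continuous_intros continuous_on_subset[OF cont]) auto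
  then obtain D where D: "0 < D" "\<And>t. t \<in> {-1..1} \<Longrightarrow> norm (\<gamma> t $ i - \<gamma> t $ j) \<le> D"
    by (auto dest!: compact_imp_bounded simp: bounded_pos)
  define \<delta> where "\<delta> = m i * m j * (1 / (D * sqrt (1 + D\<^sup>2) * (sqrt (1 + D\<^sup>2) + D)))"
  have "0 < \<delta>"
    unfolding \<delta>_def using D(1) m by (intro mult_pos_pos divide_pos_pos add_pos_pos) (auto simp: add_pos_nonneg)
  \<comment> \<open>Now \<open>\<sigma> = 1\<close> and \<open>L = 1\<close>: softening gains at
    least \<open>\<delta>\<close> at each time in \<open>{-1..1}\<close>, hence
    \<open>2 * \<delta>\<close> in all, independently of \<open>M\<close>.\<close>
  have gap: "2 * \<delta> \<le> 2 * \<mu> * R / (M - 1) + 4 / R * g M" if "1 < M" "1 \<le> R" for M R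
  proof -
    have "(\<integral>\<^sup>+t. ennreal \<delta> * indicator {-1..1::real} t \<partial>lborel) = ennreal \<delta> * ennreal 2"
      by (simp add: nn_integral_cmult_indicator)
    also have "\<dots> = ennreal (2 * \<delta>)"
      using \<open>0 < \<delta>\<close> by (subst ennreal_mult'[symmetric]) (simp_all add: mult.commute)
    finally have "S 1 M 1 + ennreal (2 * \<delta>) = S 1 M 1 + (\<integral>\<^sup>+t. ennreal \<delta> * indicator {-1..1::real} t \<partial>lborel)"
      by simp
    also have "\<dots> \<le> (\<integral>\<^sup>+t. softened_potential m (plateau 1 M t * 1) (\<gamma> t) * indicator {-M..M} t
        + ennreal \<delta> * indicator {-1..1::real} t \<partial>lborel)"
      \<comment> \<open>Superadditivity makes the step independent of measurability of the softened
        potential along \<open>\<gamma>\<close>.\<close>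
      unfolding S_def by (rule nn_integral_superadditive)
    also have "\<dots> \<le> P M"
      unfolding P_def potential_action_def
    proof (rule nn_integral_mono)
      fix t :: real
      show "softened_potential m (plateau 1 M t * 1) (\<gamma> t) * indicator {-M..M} t + ennreal \<delta> * indicator {-1..1} t
        \<le> newton_potential m (\<gamma> t) * indicator {-M..M} t"
      proof (cases "t \<in> {-1..1}")
        case True
        then have "plateau 1 M t = 1" using \<open>1 < M\<close> by (intro plateau_eq_1) auto
        then show ?thesis
          using softened_potential_gap[of m i j "\<gamma> t" D, OF m \<open>i < j\<close> D(2)[OF True] D(1), folded \<delta>_def] True \<open>1 < M\<close>
          by simp
      next
        case False
        then show ?thesis
          using softened_potential_le_newton_potential by (auto split: split_indicator)
      qed
    qed
    finally have le: "S 1 M 1 + ennreal (2 * \<delta>) \<le> P M" .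
    have "S 1 M 1 \<le> S 1 M 1 + ennreal (2 * \<delta>)" by simp
    also note le
    also have "P M < \<infinity>" using P_finite[of M] \<open>1 < M\<close> by simp
    finally have "S 1 M 1 < \<infinity>" .
    have "S 1 M 1 + ennreal (2 * \<delta>) \<le> ennreal (2 * \<mu> * 1\<^sup>2 * R / (M - 1)) + ennreal (4 / R) * P M + S 1 M 1"
      using that by (intro order_trans[OF le averaged]) auto
    then have "ennreal (2 * \<delta>) \<le> ennreal (2 * \<mu> * 1\<^sup>2 * R / (M - 1)) + ennreal (4 / R) * P M"
      using \<open>S 1 M 1 < \<infinity>\<close> by (auto simp: add.commute[of _ "S 1 M 1"] ennreal_add_left_cancel_le)
    also have "\<dots> = ennreal (2 * \<mu> * R / (M - 1) + 4 / R * g M)"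
      using that \<open>0 \<le> \<mu>\<close> g_nonneg[of M] by (simp add: P_eq ennreal_plus ennreal_mult'[symmetric])
    finally show ?thesis
      using that \<open>0 \<le> \<mu>\<close> g_nonneg[of M] by (subst (asm) ennreal_le_iff) auto
  qed
  show False
    by (rule averaged_bounds_contradiction[OF _ _ _ g_nonneg growth gap])
       (use \<open>0 < \<delta>\<close> \<open>0 \<le> B\<close> \<open>0 \<le> \<mu>\<close> in auto)
qed

end
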